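(* Let $w=(w_k)_{k\ge0}$ be a weight sequence with $w_0>0$, $w_k>0$ for all large $k$, and $w_{k+1}/w_k\to a<\infty$ as $k\to\infty$. Suppose that $n\to\infty$ and $m=m(n)$ with $m=\lambda n+o(\sqrt n)$, where $0<\lambda<\nu$. Let $\tau\in(0,\rho)$ satisfy $\Psi(\tau)=\lambda$, let $\pi_k=\tau^kw_k/\Phi(\tau)$, $\Pi_k=\sum_{l\ge k}\pi_l$, and $k_1(n)=\max\{k:\pi_k\ge1/n\}$, $k_2(n)=\max\{k:\Pi_k\ge1/n\}$, $k_3(n)=\max\{k:\sqrt{\Pi_k\Pi_{k+1}}\ge1/n\}$. (i) For each $j\ge1$, $Y_{(j)}=k_1(n)+O_p(1)=k_2(n)+O_p(1)=k_3(n)+O_p(1)$. (ii) If $a=0$, then moreover, with probability tending to $1$, $|Y_{(j)}-k_1(n)|\le1$, $|Y_{(j)}-k_2(n)|\le1$ and $Y_{(j)}\in\{k_3(n),k_3(n)+1\}$.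
   Context: A weight sequence is a sequence $w=(w_k)_{k\ge0}$ of nonnegative reals. $\Phi(t)=\sum_kw_kt^k$, $\rho$ its radius of convergence; $\Psi(t)=t\Phi'(t)/\Phi(t)$ for $\Phi(t)<\infty$, $\Psi(\rho)=\lim_{t\uparrow\rho}\Psi(t)$ if $\Phi(\rho)=\infty$; $\nu=\Psi(\rho)$. Balls-in-boxes: $\mathcal B_{m,n}=\{(y_1,\dots,y_n)\in\{0,1,\dots\}^n:\sum y_i=m\}$, weight $w(y)=\prod_iw_{y_i}$, $Z(m,n)=\sum_{y\in\mathcal B_{m,n}}w(y)$; when $Z(m,n)>0$, $B_{m,n}=(Y_1,\dots,Y_n)$ is random with $P(B_{m,n}=y)=w(y)/Z(m,n)$. $Y_{(1)}\ge Y_{(2)}\ge\dots$ denote $Y_1,\dots,Y_n$ in decreasing order. $X_n=k(n)+O_p(1)$ means $X_n-k(n)$ is tight. *)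

theory Defs
  imports "HOL-Analysis.Analysis" "HOL-Library.Landau_Symbols"
begin

definition Phi :: "(nat \<Rightarrow> real) \<Rightarrow> real \<Rightarrow> ereal" where
  "Phi w t = (\<Sum>k. ereal (w k * t ^ k))"

text \<open>t Phi'(t) = sum_k k w_k t^k, as an extended real.\<close>
definition tdPhi :: "(nat \<Rightarrow> real) \<Rightarrow> real \<Rightarrow> ereal" where
  "tdPhi w t = (\<Sum>k. ereal (real k * w k * t ^ k))"

definition rho :: "(nat \<Rightarrow> real) \<Rightarrow> ereal" where
  "rho w = conv_radius w"

definition Psi :: "(nat \<Rightarrow> real) \<Rightarrow> real \<Rightarrow> ereal" where
  "Psi w t = tdPhi w t / Phi w t"

definition nu :: "(nat \<Rightarrow> real) \<Rightarrow> ereal" where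
  "nu w = (if rho w = \<infinity> then Lim at_top (Psi w)
           else (let r = real_of_ereal (rho w) in
                 if Phi w r = \<infinity> then Lim (at_left r) (Psi w) else Psi w r))"

definition BB :: "nat \<Rightarrow> nat \<Rightarrow> nat list set" where
  "BB m n = {ys. length ys = n \<and> sum_list ys = m}"

definition wt :: "(nat \<Rightarrow> real) \<Rightarrow> nat list \<Rightarrow> real" where
  "wt w ys = prod_list (map w ys)"

definition Z :: "(nat \<Rightarrow> real) \<Rightarrow> nat \<Rightarrow> nat \<Rightarrow> real" where
  "Z w m n = (\<Sum>ys\<in>BB m n. wt w ys)"

definition BB_prob :: "(nat \<Rightarrow> real) \<Rightarrow> nat \<Rightarrow> nat \<Rightarrow> (nat list \<Rightarrow> bool) \<Rightarrow> real" where
  "BB_prob w m n E = (\<Sum>ys\<in>{ys\<in>BB m n. E ys}. wt w ys) / Z w m n"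

definition ord_stat :: "nat list \<Rightarrow> nat \<Rightarrow> nat" where
  "ord_stat ys j = rev (sort ys) ! (j - 1)"

definition tight :: "(nat \<Rightarrow> (nat list \<Rightarrow> bool) \<Rightarrow> real) \<Rightarrow> (nat \<Rightarrow> nat list \<Rightarrow> real) \<Rightarrow> bool" where
  "tight Pr X \<longleftrightarrow> (\<forall>\<epsilon>>0. \<exists>C. eventually (\<lambda>n. Pr n (\<lambda>ys. \<bar>X n ys\<bar> > C) \<le> \<epsilon>) at_top)"

end

theory Submission
  imports Defs "HOL-Probability.Characteristic_Functions" "HOL-Real_Asymp.Real_Asymp"
begin

text \<open>
  Tilting the weights by \<open>\<tau>\<close> does not change the conditional distribution, so the boxes are
  independent with law \<open>\<pi>\<close> (mean \<open>\<lambda>\<close>), conditioned on their sum \<open>S\<^sub>n\<close> being \<open>m\<close>. Fourier inversion and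
  the local limit theorem give \<open>P(S\<^sub>n = m) \<ge> c / \<surd>n\<close>. Since two consecutive \<open>\<pi>\<^sub>k\<close> are positive, the same
  inversion formula bounds the partition functions of weights obtained from \<open>\<pi>\<close> by changing it
  beyond a level \<open>K\<close>: deleting the tail yields \<open>P(Y\<^sub>(\<^sub>j\<^sub>) \<ge> K) \<le> D n \<Pi>\<^sub>K\<close>, and halving it yields
  \<open>P(Y\<^sub>(\<^sub>j\<^sub>) < K) \<le> D exp (- n \<Pi>\<^sub>K / 2)\<close>, with \<open>D\<close> independent of \<open>n\<close> and \<open>K\<close>. It remains to observe
  that \<open>n \<Pi>\<^sub>K\<close> is at least \<open>1\<close> for \<open>K = k\<^sub>i(n)\<close> and bounded for \<open>K = k\<^sub>i(n) + 2\<close>, and that \<open>\<Pi>\<close> decays at least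
  geometrically, with \<open>\<Pi>\<^sub>K\<^sub>+\<^sub>1 / \<Pi>\<^sub>K \<rightarrow> 0\<close> if \<open>a = 0\<close>.
\<close>

section \<open>Partition functions and Fourier inversion\<close>

lemma BB_0: "BB m 0 = (if m = 0 then {[]} else {})"
  by (auto simp: BB_def)

lemma BB_Suc: "BB m (Suc n) = (\<Union>k\<le>m. (#) k ` BB (m - k) n)"
proof (rule set_eqI)
  fix ys
  show "ys \<in> BB m (Suc n) \<longleftrightarrow> ys \<in> (\<Union>k\<le>m. (#) k ` BB (m - k) n)"
    by (cases ys) (auto simp: BB_def image_iff)
qed

lemma finite_BB: "finite (BB m n)"
  by (induction n arbitrary: m) (auto simp: BB_0 BB_Suc)

lemma wt_Cons [simp]: "wt g (k # ys) = g k * wt g ys"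
  by (simp add: wt_def)

lemma wt_nonneg: "(\<And>k. g k \<ge> 0) \<Longrightarrow> wt g ys \<ge> 0"
  by (induction ys) (auto simp: wt_def)

lemma Z_nonneg: "(\<And>k. g k \<ge> 0) \<Longrightarrow> Z g m n \<ge> 0"
  unfolding Z_def by (intro sum_nonneg wt_nonneg)

lemma Z_0: "Z g m 0 = of_bool (m = 0)"
  by (simp add: Z_def BB_0 wt_def)

lemma Z_Suc: "Z g m (Suc n) = (\<Sum>k\<le>m. g k * Z g (m - k) n)"
proof -
  have "Z g m (Suc n) = (\<Sum>k\<le>m. \<Sum>ys\<in>(#) k ` BB (m - k) n. wt g ys)"
    unfolding Z_def BB_Suc by (rule sum.UNION_disjoint) (auto simp: finite_BB)
  also have "\<dots> = (\<Sum>k\<le>m. g k * Z g (m - k) n)"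
    by (intro sum.cong refl, subst sum.reindex) (auto simp: Z_def sum_distrib_left)
  finally show ?thesis .
qed

text \<open>The characteristic function of the measure with masses \<open>g k\<close>. The total
  mass is left free because truncated and halved laws are inserted below.\<close>

definition fourier :: "(nat \<Rightarrow> real) \<Rightarrow> real \<Rightarrow> complex" where
  "fourier g t = (\<Sum>k. of_real (g k) * cis (t * real k))"

lemma fourier_summable:
  assumes "\<And>k. g k \<ge> 0" "summable g"
  shows "summable (\<lambda>k. of_real (g k) * cis (t * real k))"
    and "summable (\<lambda>k. norm (of_real (g k) * cis (t * real k)))"
proof -
  show "summable (\<lambda>k. norm (of_real (g k) * cis (t * real k)))"
    using assms by (simp add: norm_mult)
  then show "summable (\<lambda>k. of_real (g k) * cis (t * real k))"
    by (rule summable_norm_cancel)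
qed

lemma norm_fourier_le_suminf:
  assumes "\<And>k. g k \<ge> 0" "summable g"
  shows "norm (fourier g t) \<le> (\<Sum>k. g k)"
  using summable_norm[OF fourier_summable(2)[OF assms, of t]] assms
  by (simp add: fourier_def norm_mult)

lemma fourier_add:
  assumes "\<And>k. f k \<ge> 0" "summable f" "\<And>k. g k \<ge> 0" "summable g"
  shows "fourier (\<lambda>k. f k + g k) t = fourier f t + fourier g t"
  unfolding fourier_def
  by (subst suminf_add) (auto simp: algebra_simps intro: fourier_summable assms)

text \<open>By \<open>Z_Suc\<close>, \<open>Z g _ n\<close> is the n-fold convolution power of
  \<open>g\<close>, so each induction step is a Cauchy product. Summability is carried along in the
  induction because that product needs absolute convergence.\<close>

lemma fourier_power_sums:
  assumes g: "\<And>k. g k \<ge> 0" "summable g"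
  shows "summable (\<lambda>m. Z g m n) \<and> (\<lambda>m. of_real (Z g m n) * cis (t * real m)) sums (fourier g t ^ n)"
proof (induction n)
  case 0
  have "(\<lambda>m. of_bool (m = 0)) sums (1::real)"
    using sums_single[of 0 "\<lambda>_. 1::real"] by (simp add: of_bool_def)
  moreover have "(\<lambda>m. of_real (of_bool (m = 0)) * cis (t * real m)) sums 1"
    using sums_single[of 0 "\<lambda>m. cis (t * real m)"]
    by (simp add: of_bool_def if_distrib[of of_real] if_distrib[of "\<lambda>x. x * _"] cong: if_cong)
  ultimately show ?case by (auto simp: Z_0 sums_iff)
next
  case (Suc n)
  have Zn: "Z g m n \<ge> 0" for m by (rule Z_nonneg) (rule g)
  have 1: "summable (\<lambda>m. Z g m (Suc n))"
    unfolding Z_Suc using g Suc Zn by (intro summable_Cauchy_product) simp_all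
  have "(\<lambda>m. \<Sum>k\<le>m. (of_real (g k) * cis (t * real k)) * (of_real (Z g (m - k) n) * cis (t * real (m - k))))
      sums ((\<Sum>k. of_real (g k) * cis (t * real k)) * (\<Sum>m. of_real (Z g m n) * cis (t * real m)))"
    using Suc Zn g by (intro Cauchy_product_sums) (simp_all add: norm_mult)
  also have "(\<lambda>m. \<Sum>k\<le>m. (of_real (g k) * cis (t * real k)) * (of_real (Z g (m - k) n) * cis (t * real (m - k))))
      = (\<lambda>m. complex_of_real (Z g m (Suc n)) * cis (t * real m))"
  proof
    fix m
    have *: "cis (t * real k) * cis (t * real (m - k)) = cis (t * real m)" if "k \<le> m" for k
      using that by (simp add: cis_mult of_nat_diff algebra_simps)
    show "(\<Sum>k\<le>m. (of_real (g k) * cis (t * real k)) * (of_real (Z g (m - k) n) * cis (t * real (m - k))))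
      = complex_of_real (Z g m (Suc n)) * cis (t * real m)"
      unfolding Z_Suc of_real_sum sum_distrib_right
      by (rule sum.cong) (simp_all add: *[symmetric])
  qed
  also have "(\<Sum>m. of_real (Z g m n) * cis (t * real m)) = fourier g t ^ n"
    using Suc by (simp add: sums_iff)
  finally show ?case using 1 by (simp add: fourier_def)
qed

text \<open>Orthogonality of characters: for \<open>k \<noteq> 0\<close> the antiderivative takes
  the same value at both ends of the period, as \<open>sin (pi * k)\<close> vanishes for integer
  \<open>k\<close>.\<close>

lemma has_bochner_integral_cis:
  "has_bochner_integral lborel (\<lambda>t. indicator {-pi..pi} t *\<^sub>R cis (t * of_int k)) (if k = 0 then of_real (2 * pi) else 0)"
proof (cases "k = 0")
  case True
  have "has_bochner_integral lborel (\<lambda>t. indicator {-pi..pi} t *\<^sub>R (1::complex)) (of_real pi - of_real (-pi))"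
    by (rule has_bochner_integral_FTC_Icc[where F=of_real])
       (auto intro!: derivative_eq_intros simp: has_vector_derivative_def scaleR_conv_of_real)
  then show ?thesis using True by simp
next
  case False
  let ?F = "\<lambda>t. cis (t * of_int k) / (\<i> * of_int k)"
  have "has_bochner_integral lborel (\<lambda>t. indicator {-pi..pi} t *\<^sub>R cis (t * of_int k)) (?F pi - ?F (-pi))"
  proof (rule has_bochner_integral_FTC_Icc)
    show "continuous_on {-pi..pi} (\<lambda>t. cis (t * of_int k))"
      by (intro continuous_intros)
    fix t :: real
    have "((\<lambda>t. cis (t * of_int k)) has_derivative (\<lambda>x. (x * of_int k) *\<^sub>R (\<i> * cis (t * of_int k)))) (at t within {-pi..pi})"
      by (auto intro!: derivative_eq_intros)
    then show "(?F has_vector_derivative cis (t * of_int k)) (at t within {-pi..pi})"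
      unfolding has_vector_derivative_def using False
      by (auto intro!: derivative_eq_intros simp: scaleR_conv_of_real fun_eq_iff field_simps)
  qed simp
  moreover have "cis (pi * of_int k) = cis (- (pi * of_int k))"
    by (simp add: complex_eq_iff sin_zero_iff_int2)
  ultimately show ?thesis using False by simp
qed

text \<open>Integrate the series of \<open>fourier_power_sums\<close> term by term; orthogonality
  keeps only the term \<open>l = m\<close>. The exchange is legitimate because the norms of the
  terms are \<open>Z g l n\<close> on the interval, which are summable in \<open>l\<close>.\<close>

lemma fourier_inversion:
  assumes g: "\<And>k. g k \<ge> 0" "summable g"
  shows "has_bochner_integral lborel
     (\<lambda>t. indicator {-pi..pi} t *\<^sub>R (fourier g t ^ n * cis (- (t * real m)))) (of_real (2 * pi * Z g m n))"
proof -
  define f where "f = (\<lambda>l t. indicator {-pi..pi} t *\<^sub>R (of_real (Z g l n) * cis (t * real l) * cis (- (t * real m))))"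
  note S = fourier_power_sums[OF g, of n]
  have Zn: "Z g m n \<ge> 0" for m by (rule Z_nonneg) (rule g)
  have f: "has_bochner_integral lborel (f l) (if l = m then of_real (2 * pi * Z g l n) else 0)" for l
  proof -
    have "has_bochner_integral lborel (\<lambda>t. of_real (Z g l n) * (indicator {-pi..pi} t *\<^sub>R cis (t * of_int (int l - int m))))
       (of_real (Z g l n) * (if int l - int m = 0 then of_real (2 * pi) else 0))"
      using has_bochner_integral_cis by (rule has_bochner_integral_mult_right)
    also have "(\<lambda>t. of_real (Z g l n) * (indicator {-pi..pi} t *\<^sub>R cis (t * of_int (int l - int m)))) = f l"
      by (simp add: f_def fun_eq_iff cis_mult right_diff_distrib)
    also have "of_real (Z g l n) * (if int l - int m = 0 then of_real (2 * pi) else 0)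
        = (if l = m then complex_of_real (2 * pi * Z g l n) else 0)" by simp
    finally show ?thesis .
  qed
  have sums_f: "(\<lambda>l. f l t) sums (indicator {-pi..pi} t *\<^sub>R (fourier g t ^ n * cis (- (t * real m))))" for t
    unfolding f_def using S[of t] by (intro sums_scaleR_right sums_mult2) auto
  have nf: "norm (f l t) = Z g l n * indicator {-pi..pi} t" for l t
    using Zn by (simp add: f_def norm_mult indicator_def)
  have intf: "integrable lborel (f l)" for l using f by (rule integrable.intros)
  have sum1: "AE t in lborel. summable (\<lambda>l. norm (f l t))"
    using S by (intro AE_I2) (auto simp: nf intro: summable_mult2)
  have sum2: "summable (\<lambda>l. \<integral>t. norm (f l t) \<partial>lborel)"
    unfolding nf using S by (simp add: summable_mult2)
  have "(\<Sum>l. integral\<^sup>L lborel (f l)) = (\<Sum>l. if l = m then of_real (2 * pi * Z g l n) else 0)"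
    using f by (intro arg_cong[where f=suminf] ext has_bochner_integral_integral_eq)
  also have "\<dots> = of_real (2 * pi * Z g m n)"
    using sums_single[of m "\<lambda>l. complex_of_real (2 * pi * Z g l n)"] by (simp add: sums_iff)
  finally show ?thesis
    using integrable_suminf[OF intf sum1 sum2] integral_suminf[OF intf sum1 sum2] sums_f
    by (simp add: has_bochner_integral_iff sums_iff)
qed

section \<open>Gaussian bounds from two adjacent atoms\<close>

lemma cos_le_quadratic:
  assumes "\<bar>x\<bar> \<le> pi / 2"
  shows "cos x \<le> 1 - x\<^sup>2 / 3"
proof -
  obtain t where t: "cos x = (\<Sum>m<4. cos_coeff m * x ^ m) + cos (t + 1/2 * real (4::nat) * pi) / fact 4 * x ^ 4"
    using Maclaurin_cos_expansion[of x 4] by auto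
  have "(\<Sum>m<4. cos_coeff m * x ^ m) = 1 - x\<^sup>2 / 2"
    by (simp add: cos_coeff_def lessThan_nat_numeral)
  moreover have "cos (t + 1/2 * real (4::nat) * pi) / fact 4 * x ^ 4 \<le> x ^ 4 / 24"
    using mult_right_mono[of "cos t" 1 "x ^ 4"] by (simp add: fact_numeral)
  \<comment> \<open>From \<open>pi < 4\<close> one gets \<open>\<bar>x\<bar> \<le> 2\<close>, so the
    remainder \<open>x ^ 4 / 24\<close> is at most a sixth of the square. This turns the coefficient
    1/2 into 1/3.\<close>
  moreover have "\<bar>x\<bar>\<^sup>2 \<le> 2\<^sup>2" using assms pi_less_4 by (intro power_mono) auto
  then have "x\<^sup>2 * x\<^sup>2 \<le> 4 * x\<^sup>2" by (intro mult_right_mono) auto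
  then have "x ^ 4 \<le> 4 * x\<^sup>2" by (simp add: power4_eq_xxxx power2_eq_square mult.assoc)
  ultimately show ?thesis unfolding t by linarith
qed

text \<open>Split off mass \<open>d\<close> at each of \<open>k\<close> and \<open>Suc k\<close>.
  These two atoms together contribute modulus \<open>2 * d * cos (t / 2)\<close>, which decays
  quadratically on all of \<open>[-pi, pi]\<close> because the atoms are adjacent; the remaining
  measure is bounded by its mass. Finally \<open>1 + x \<le> exp x\<close> makes the bound suitable
  for taking n-th powers.\<close>

lemma norm_fourier_le_exp:
  assumes g: "\<And>k. g k \<ge> 0" "summable g" and d: "0 \<le> d" "d \<le> g k" "d \<le> g (Suc k)"
    and t: "\<bar>t\<bar> \<le> pi"
  shows "norm (fourier g t) \<le> exp ((\<Sum>k. g k) - 1 - d / 6 * t\<^sup>2)"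
proof -
  define e where "e = (\<lambda>i. if i \<in> {k, Suc k} then d else 0)"
  have e0: "e i \<ge> 0" "e i \<le> g i" for i using d g by (auto simp: e_def)
  have es: "e sums (2 * d)"
    using sums_If_finite_set[of "{k, Suc k}" "\<lambda>_. d"] by (simp add: e_def)
  then have se: "summable e" "(\<Sum>i. e i) = 2 * d" by (auto simp: sums_iff)
  have "(\<lambda>i. of_real (e i) * cis (t * real i)) sums (of_real d * (cis (t * real k) + cis (t * real (Suc k))))"
    using sums_If_finite_set[of "{k, Suc k}" "\<lambda>i. of_real d * cis (t * real i)"]
    by (simp add: e_def if_distrib[of of_real] if_distrib[of "\<lambda>x. x * _"] distrib_left cong: if_cong)
  then have fe: "fourier e t = of_real d * (cis (t * real k) + cis (t * real (Suc k)))"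
    by (simp add: fourier_def sums_iff)
  \<comment> \<open>Pulling out the phase of the midpoint \<open>k + 1/2\<close> leaves a real
    factor.\<close>
  have "cis (t * real k) + cis (t * real (Suc k)) = of_real (2 * cos (t / 2)) * cis (t * real k + t / 2)"
  proof -
    have "of_real (2 * cos (t / 2)) = cis (t / 2) + cis (- (t / 2))"
      by (simp add: complex_eq_iff)
    then show ?thesis by (simp add: distrib_right cis_mult algebra_simps)
  qed
  then have "norm (fourier e t) = d * \<bar>2 * cos (t / 2)\<bar>"
    using d unfolding fe by (simp only: norm_mult norm_of_real norm_cis mult_1_right abs_of_nonneg)
  moreover have "cos (t / 2) \<ge> 0" using t by (intro cos_ge_zero) auto
  moreover have "cos (t / 2) \<le> 1 - t\<^sup>2 / 12"
    using cos_le_quadratic[of "t / 2"] t by (simp add: power_divide)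
  then have "d * (2 * cos (t / 2)) \<le> d * (2 * (1 - t\<^sup>2 / 12))"
    using d by (intro mult_left_mono) auto
  ultimately have 1: "norm (fourier e t) \<le> 2 * d - d / 6 * t\<^sup>2"
    by (simp add: algebra_simps)
  have 2: "norm (fourier (\<lambda>i. g i - e i) t) \<le> (\<Sum>i. g i) - 2 * d"
    using norm_fourier_le_suminf[of "\<lambda>i. g i - e i" t] e0 se g
    by (simp add: suminf_diff[symmetric] summable_diff)
  have "fourier g t = fourier (\<lambda>i. g i - e i) t + fourier e t"
    using fourier_add[of "\<lambda>i. g i - e i" e t] e0 se g by (simp add: summable_diff)
  then have "norm (fourier g t) \<le> (\<Sum>i. g i) - d / 6 * t\<^sup>2"
    using norm_triangle_ineq[of "fourier (\<lambda>i. g i - e i) t" "fourier e t"] 1 2 by simp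
  also have "\<dots> \<le> exp ((\<Sum>i. g i) - 1 - d / 6 * t\<^sup>2)"
    using exp_ge_add_one_self[of "(\<Sum>i. g i) - 1 - d / 6 * t\<^sup>2"] by simp
  finally show ?thesis .
qed

lemma has_bochner_integral_gaussian:
  assumes "c > 0"
  shows "has_bochner_integral lborel (\<lambda>t. exp (- c * t\<^sup>2)) (sqrt (pi / c))"
proof -
  \<comment> \<open>The standard deviation of the centred normal density proportional to
    \<open>exp (- c * t\<^sup>2)\<close>.\<close>
  define s where "s = sqrt (1 / (2 * c))"
  have s: "s > 0" "s\<^sup>2 = 1 / (2 * c)" using assms by (auto simp: s_def)
  have "has_bochner_integral lborel (\<lambda>t. sqrt (pi / c) * normal_density 0 s t) (sqrt (pi / c) * 1)"
    using s by (intro has_bochner_integral_mult_right) (simp add: has_bochner_integral_iff)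
  moreover have "sqrt (pi / c) * normal_density 0 s t = exp (- c * t\<^sup>2)" for t
    using assms s by (simp add: normal_density_def real_sqrt_divide)
  ultimately show ?thesis by simp
qed

lemma norm_has_bochner_integral_le_gaussian:
  fixes f :: "real \<Rightarrow> complex"
  assumes f: "has_bochner_integral lborel f I" and le: "\<And>t. norm (f t) \<le> C * exp (- c * t\<^sup>2)" and c: "c > 0"
  shows "norm I \<le> C * sqrt (pi / c)"
proof -
  have G: "has_bochner_integral lborel (\<lambda>t. C * exp (- c * t\<^sup>2)) (C * sqrt (pi / c))"
    using c by (intro has_bochner_integral_mult_right has_bochner_integral_gaussian)
  have "norm (integral\<^sup>L lborel f) \<le> (\<integral>t. C * exp (- c * t\<^sup>2) \<partial>lborel)"
    by (rule Bochner_Integration.integral_norm_bound_integral[OF integrable.intros[OF f] integrable.intros[OF G] le])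
  then show ?thesis
    unfolding has_bochner_integral_integral_eq[OF f] has_bochner_integral_integral_eq[OF G] .
qed

text \<open>Both bounds below are constant-factor versions of the local limit theorem; \<open>d\<close> only has to
  bound two consecutive weights from below, so they are uniform over modifications of the
  distribution far out in the tail.\<close>

lemma Z_le_exp:
  assumes g: "\<And>k. g k \<ge> 0" "summable g" and d: "0 < d" "d \<le> g k" "d \<le> g (Suc k)" and n: "n > 0"
  shows "2 * pi * Z g m n \<le> exp (- (real n * (1 - (\<Sum>k. g k)))) * sqrt (6 * pi / (d * real n))"
proof -
  have "norm (complex_of_real (2 * pi * Z g m n)) \<le> exp (- (real n * (1 - (\<Sum>k. g k)))) * sqrt (pi / (d * real n / 6))"
  proof (rule norm_has_bochner_integral_le_gaussian[OF fourier_inversion[OF g]])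
    fix t :: real
    \<comment> \<open>The mass defect of \<open>g\<close> enters the bound uniformly in
      \<open>t\<close>, so the n-th power turns it into an exponentially small factor.\<close>
    have "norm (fourier g t) ^ n \<le> exp ((\<Sum>k. g k) - 1 - d / 6 * t\<^sup>2) ^ n" if "\<bar>t\<bar> \<le> pi"
      using that d by (intro power_mono norm_fourier_le_exp g) auto
    also have "exp ((\<Sum>k. g k) - 1 - d / 6 * t\<^sup>2) ^ n
        = exp (- (real n * (1 - (\<Sum>k. g k)))) * exp (- (d * real n / 6) * t\<^sup>2)"
      by (simp add: exp_of_nat_mult[symmetric] exp_add[symmetric] algebra_simps)
    finally show "norm (indicator {-pi..pi} t *\<^sub>R (fourier g t ^ n * cis (- (t * real m))))
        \<le> exp (- (real n * (1 - (\<Sum>k. g k)))) * exp (- (d * real n / 6) * t\<^sup>2)"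
      by (auto simp: norm_mult norm_power indicator_def abs_le_iff)
  qed (use d n in auto)
  then show ?thesis
    using Z_nonneg[of g m n] g unfolding norm_of_real by (simp add: abs_mult mult.commute)
qed

text \<open>Factor out \<open>x - y\<close>; the cofactor has \<open>n\<close> terms, each of norm
  at most \<open>r ^ (n - 1)\<close>. Keeping this power preserves the Gaussian decay when
  \<open>r\<close> itself depends on \<open>t\<close>.\<close>

lemma norm_power_diff_le:
  fixes x y :: "'a :: real_normed_field"
  assumes "norm x \<le> r" "norm y \<le> r"
  shows "norm (x ^ n - y ^ n) \<le> real n * r ^ (n - 1) * norm (x - y)"
proof -
  have r: "r \<ge> 0" using assms(1) norm_ge_zero order.trans by blast
  have "norm (\<Sum>i<n. y ^ (n - Suc i) * x ^ i) \<le> (\<Sum>i<n. r ^ (n - 1))"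
  proof (rule sum_norm_le)
    fix i assume i: "i \<in> {..<n}"
    have "norm (y ^ (n - Suc i) * x ^ i) \<le> r ^ (n - Suc i) * r ^ i"
      unfolding norm_mult norm_power using assms r by (intro mult_mono power_mono) auto
    also have "\<dots> = r ^ (n - 1)" using i by (simp add: power_add[symmetric])
    finally show "norm (y ^ (n - Suc i) * x ^ i) \<le> r ^ (n - 1)" .
  qed
  then have "norm (x - y) * norm (\<Sum>i<n. y ^ (n - Suc i) * x ^ i) \<le> norm (x - y) * (real n * r ^ (n - 1))"
    by (intro mult_left_mono) auto
  then show ?thesis
    by (simp add: power_diff_sumr2 norm_mult mult_ac)
qed

lemma Z_diff_le:
  assumes g: "\<And>k. g k \<ge> 0" and f: "summable f" "\<And>k. g k \<le> f k" "(\<Sum>k. f k) \<le> 1"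
    and d: "0 < d" "d \<le> g k" "d \<le> g (Suc k)" and n: "n > 1"
  shows "2 * pi * (Z f m n - Z g m n) \<le> real n * (\<Sum>k. f k - g k) * sqrt (6 * pi / (d * real (n - 1)))"
proof -
  have f0: "f k \<ge> 0" for k using g f(2) order.trans by blast
  have sg: "summable g" 
    by (rule summable_comparison_test'[OF f(1), of 0]) (simp add: g f(2))
  have sfg: "(\<Sum>k. g k) \<le> (\<Sum>k. f k)" using f sg by (intro suminf_le)
  have "2 * pi * (Z f m n - Z g m n) \<le> norm (complex_of_real (2 * pi * Z f m n) - complex_of_real (2 * pi * Z g m n))"
    unfolding of_real_diff[symmetric] norm_of_real by (simp add: right_diff_distrib)
  also have "\<dots> \<le> real n * (\<Sum>k. f k - g k) * sqrt (pi / (d * real (n - 1) / 6))"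
  proof (rule norm_has_bochner_integral_le_gaussian[OF has_bochner_integral_diff[OF fourier_inversion[OF f0 f(1)] fourier_inversion[OF g sg]]])
    fix t :: real
    \<comment> \<open>Neither mass exceeds one, so both transforms lie below the same Gaussian. One
      of the \<open>n\<close> factors is spent on the deleted mass and \<open>n - 1\<close> Gaussian
      factors remain, whence \<open>n > 1\<close>.\<close>
    have "norm (fourier f t ^ n - fourier g t ^ n) \<le> real n * exp (- d / 6 * t\<^sup>2) ^ (n - 1) * norm (fourier f t - fourier g t)"
      if "\<bar>t\<bar> \<le> pi"
    proof (rule norm_power_diff_le)
      have "norm (fourier f t) \<le> exp ((\<Sum>k. f k) - 1 - d / 6 * t\<^sup>2)"
        using d f(2)[of k] f(2)[of "Suc k"] that by (intro norm_fourier_le_exp[where k=k] f0 f) auto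
      also have "\<dots> \<le> exp (- d / 6 * t\<^sup>2)" using f(3) by simp
      finally show "norm (fourier f t) \<le> exp (- d / 6 * t\<^sup>2)" .
      have "norm (fourier g t) \<le> exp ((\<Sum>k. g k) - 1 - d / 6 * t\<^sup>2)"
        using d that by (intro norm_fourier_le_exp[where k=k] g sg) auto
      also have "\<dots> \<le> exp (- d / 6 * t\<^sup>2)" using f(3) sfg by simp
      finally show "norm (fourier g t) \<le> exp (- d / 6 * t\<^sup>2)" .
    qed
    moreover have "fourier f t = fourier (\<lambda>k. f k - g k) t + fourier g t"
      using fourier_add[of "\<lambda>k. f k - g k" g t] f g sg by (simp add: summable_diff)
    then have "norm (fourier f t - fourier g t) \<le> (\<Sum>k. f k - g k)"
      using norm_fourier_le_suminf[of "\<lambda>k. f k - g k" t] f g sg by (simp add: summable_diff)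
    then have "real n * exp (- d / 6 * t\<^sup>2) ^ (n - 1) * norm (fourier f t - fourier g t)
         \<le> real n * exp (- d / 6 * t\<^sup>2) ^ (n - 1) * (\<Sum>k. f k - g k)"
      by (intro mult_left_mono) auto
    moreover have "exp (- d / 6 * t\<^sup>2) ^ (n - 1) = exp (- (d * real (n - 1) / 6) * t\<^sup>2)"
      by (simp add: exp_of_nat_mult[symmetric])
    ultimately have "norm (fourier f t ^ n - fourier g t ^ n)
         \<le> real n * (\<Sum>k. f k - g k) * exp (- (d * real (n - 1) / 6) * t\<^sup>2)" if "\<bar>t\<bar> \<le> pi"
      using that by (simp add: mult_ac)
    moreover have "0 \<le> (\<Sum>k. f k - g k)"
      using f sg by (intro suminf_nonneg summable_diff) auto
    ultimately show "norm (indicator {-pi..pi} t *\<^sub>R (fourier f t ^ n * cis (- (t * real m)))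
        - indicator {-pi..pi} t *\<^sub>R (fourier g t ^ n * cis (- (t * real m))))
        \<le> real n * (\<Sum>k. f k - g k) * exp (- (d * real (n - 1) / 6) * t\<^sup>2)"
      by (auto simp: norm_mult indicator_def abs_le_iff left_diff_distrib[symmetric])
  qed (use d n in auto)
  finally show ?thesis by (simp add: mult.commute)
qed

section \<open>The local limit theorem\<close>

lemma norm_cis_taylor_le: "norm (cis y - (1 + \<i> * y - y\<^sup>2 / 2)) \<le> \<bar>y\<bar> ^ 3 / 6"
proof -
  have "(\<Sum>k\<le>2. (\<i> * y) ^ k / fact k) = 1 + \<i> * y - y\<^sup>2 / 2"
    by (simp add: eval_nat_numeral power2_eq_square field_simps)
  then show ?thesis using iexp_approx1[of y 2]
    by (simp add: cis_conv_exp fact_numeral numeral_3_eq_3[symmetric])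
qed

text \<open>Substitute \<open>t = s / sqrt n\<close> in the inversion formula. The integrand
  converges pointwise to a Gaussian, and the two-atom bound supplies a dominating Gaussian on the
  whole range, so dominated convergence applies. The limit is
  \<open>sqrt (2 * pi / variance)\<close>.\<close>

lemma local_limit:
  assumes p: "\<And>k. p k \<ge> 0" "p sums 1" and mean: "(\<lambda>k. real k * p k) sums lam"
    and p3: "summable (\<lambda>k. real k ^ 3 * p k)"
    and d: "0 < d" "d \<le> p k" "d \<le> p (Suc k)"
    and m: "(\<lambda>n. (real (m n) - lam * real n) / sqrt (real n)) \<longlonglongrightarrow> 0"
  shows "\<exists>v>0. (\<lambda>n. sqrt (real n) * (2 * pi * Z p (m n) n)) \<longlonglongrightarrow> v"
proof -
  define x where "x = (\<lambda>k. real k - lam)"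
  \<comment> \<open>The characteristic function of the law centred at its mean.\<close>
  define \<psi> where "\<psi> = (\<lambda>t. fourier p t * cis (- (t * lam)))"
  have sp: "summable p" using p(2) by (rule sums_summable)
  have p1: "summable (\<lambda>k. real k * p k)" using mean by (rule sums_summable)
  have p2: "summable (\<lambda>k. real k ^ 2 * p k)"
  proof (rule summable_comparison_test'[OF p3, of 0])
    fix k :: nat
    have "k ^ 2 \<le> k ^ 3" by (cases "k = 0") (auto intro: power_increasing)
    then have "real k ^ 2 \<le> real k ^ 3" by (simp flip: of_nat_power)
    then show "norm (real k ^ 2 * p k) \<le> real k ^ 3 * p k"
      using p(1)[of k] by (simp add: mult_right_mono)
  qed
  have x2: "summable (\<lambda>k. p k * x k ^ 2)"
  proof -
    have "summable (\<lambda>k. real k ^ 2 * p k - 2 * lam * (real k * p k) + lam ^ 2 * p k)"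
      by (intro summable_add summable_diff summable_mult sp p1 p2)
    then show ?thesis by (simp add: x_def power2_eq_square algebra_simps)
  qed
  have x3: "summable (\<lambda>k. p k * \<bar>x k\<bar> ^ 3)"
  proof (rule summable_comparison_test'[of _ 0])
    show "summable (\<lambda>k. real k ^ 3 * p k + 3 * \<bar>lam\<bar> * (real k ^ 2 * p k) + 3 * \<bar>lam\<bar> ^ 2 * (real k * p k) + \<bar>lam\<bar> ^ 3 * p k)"
      by (intro summable_add summable_mult sp p1 p2 p3)
    fix k :: nat
    have "\<bar>x k\<bar> ^ 3 \<le> (real k + \<bar>lam\<bar>) ^ 3" by (intro power_mono) (auto simp: x_def)
    then have "p k * \<bar>x k\<bar> ^ 3 \<le> p k * (real k + \<bar>lam\<bar>) ^ 3"
      using p(1) by (intro mult_left_mono)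
    also have "\<dots> = real k ^ 3 * p k + 3 * \<bar>lam\<bar> * (real k ^ 2 * p k) + 3 * \<bar>lam\<bar> ^ 2 * (real k * p k) + \<bar>lam\<bar> ^ 3 * p k"
      by (simp add: power3_eq_cube power2_eq_square algebra_simps)
    finally show "norm (p k * \<bar>x k\<bar> ^ 3) \<le> \<dots>" using p(1)[of k] by (simp add: abs_mult)
  qed
  define v where "v = (\<Sum>k. p k * x k ^ 2)"
  define M where "M = (\<Sum>k. p k * \<bar>x k\<bar> ^ 3)"
  have M: "M \<ge> 0" unfolding M_def using p by (intro suminf_nonneg x3) auto
  have v: "v > 0"
  proof -
    \<comment> \<open>The mean cannot coincide with both atoms, so the variance is positive.\<close>
    have "x k \<noteq> 0 \<or> x (Suc k) \<noteq> 0" by (auto simp: x_def)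
    then obtain i where "p i * x i ^ 2 > 0" using d by (smt (verit) mult_pos_pos zero_less_power2)
    then show ?thesis unfolding v_def using p(1) by (intro suminf_pos2[OF x2]) auto
  qed
  have x1: "(\<lambda>k. p k * x k) sums 0"
    using sums_diff[OF mean sums_mult[OF p(2), of lam]] by (simp add: x_def algebra_simps)
  have \<psi>: "(\<lambda>k. of_real (p k) * cis (t * x k)) sums \<psi> t" for t
  proof -
    have "(\<lambda>k. of_real (p k) * cis (t * real k)) sums fourier p t"
      unfolding fourier_def using fourier_summable(1)[OF p(1) sp] by (rule summable_sums)
    then have "(\<lambda>k. of_real (p k) * cis (t * real k) * cis (- (t * lam))) sums \<psi> t"
      unfolding \<psi>_def by (rule sums_mult2)
    then show ?thesis by (simp add: mult.assoc cis_mult x_def right_diff_distrib)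
  qed
  \<comment> \<open>Expand each \<open>cis\<close> to second order and sum: the linear term vanishes
    by centring, and the third absolute moment \<open>M\<close> controls the error.\<close>
  have \<psi>_taylor: "norm (\<psi> t - of_real (1 - v / 2 * t\<^sup>2)) \<le> \<bar>t\<bar> ^ 3 * M / 6" for t
  proof -
    have "(\<lambda>k. complex_of_real (p k) + \<i> * t * complex_of_real (p k * x k) - t\<^sup>2 / 2 * complex_of_real (p k * x k ^ 2))
        sums (complex_of_real 1 + \<i> * t * complex_of_real 0 - t\<^sup>2 / 2 * complex_of_real v)"
      unfolding v_def using p x1 x2
      by (intro sums_add sums_diff sums_mult sums_of_real summable_sums)
    then have S: "(\<lambda>k. of_real (p k) * cis (t * x k) - (complex_of_real (p k) + \<i> * t * complex_of_real (p k * x k) - t\<^sup>2 / 2 * complex_of_real (p k * x k ^ 2)))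
        sums (\<psi> t - (complex_of_real 1 + \<i> * t * complex_of_real 0 - t\<^sup>2 / 2 * complex_of_real v))"
      by (rule sums_diff[OF \<psi>])
    have le: "norm (of_real (p k) * cis (t * x k) - (complex_of_real (p k) + \<i> * t * complex_of_real (p k * x k) - t\<^sup>2 / 2 * complex_of_real (p k * x k ^ 2)))
        \<le> \<bar>t\<bar> ^ 3 / 6 * (p k * \<bar>x k\<bar> ^ 3)" for k
    proof -
      have "of_real (p k) * cis (t * x k) - (complex_of_real (p k) + \<i> * t * complex_of_real (p k * x k) - t\<^sup>2 / 2 * complex_of_real (p k * x k ^ 2))
         = of_real (p k) * (cis (t * x k) - (1 + \<i> * (t * x k) - (t * x k)\<^sup>2 / 2))"
        by (simp add: algebra_simps power_mult_distrib)
      also have "norm \<dots> \<le> p k * (\<bar>t * x k\<bar> ^ 3 / 6)"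
        unfolding norm_mult norm_of_real abs_of_nonneg[OF p(1)]
        using norm_cis_taylor_le[of "t * x k"] p(1)[of k] by (intro mult_left_mono) simp_all
      finally show ?thesis by (simp add: abs_mult power_mult_distrib mult_ac)
    qed
    have "norm (\<psi> t - (complex_of_real 1 + \<i> * t * complex_of_real 0 - t\<^sup>2 / 2 * complex_of_real v))
       \<le> (\<Sum>k. \<bar>t\<bar> ^ 3 / 6 * (p k * \<bar>x k\<bar> ^ 3))"
      unfolding sums_unique[OF S] by (rule norm_suminf_le[OF le]) (rule summable_mult[OF x3])
    then show ?thesis unfolding suminf_mult[OF x3] M_def[symmetric] by (simp add: mult_ac)
  qed
  have n\<psi>: "norm (\<psi> t) \<le> 1" for t
    using norm_fourier_le_suminf[OF p(1) sp, of t] p(2) by (simp add: \<psi>_def norm_mult sums_iff)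
  \<comment> \<open>Compare with the n-th power of \<open>1 - v * s\<^sup>2 / (2 * n)\<close>. Once
    both bases have norm at most one, the powers differ by at most \<open>n\<close> times the
    difference of the bases, which is of order \<open>1 / sqrt n\<close> by the Taylor
    bound.\<close>
  have lim\<psi>: "(\<lambda>n. \<psi> (s / sqrt (real n)) ^ n) \<longlonglongrightarrow> of_real (exp (- v / 2 * s\<^sup>2))" for s
  proof -
    have E: "(\<lambda>n. complex_of_real ((1 + (- v / 2 * s\<^sup>2) / real n) ^ n)) \<longlonglongrightarrow> of_real (exp (- v / 2 * s\<^sup>2))"
      by (intro tendsto_of_real tendsto_exp_limit_sequentially)
    have "(\<lambda>n. \<psi> (s / sqrt (real n)) ^ n - complex_of_real ((1 + (- v / 2 * s\<^sup>2) / real n) ^ n)) \<longlonglongrightarrow> 0"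
    proof (rule Lim_null_comparison)
      show "(\<lambda>n. \<bar>s\<bar> ^ 3 * M / 6 / sqrt (real n)) \<longlonglongrightarrow> 0"
        by real_asymp
      have "eventually (\<lambda>n. v / 2 * s\<^sup>2 / real n < 1) at_top" by real_asymp
      then show "eventually (\<lambda>n. norm (\<psi> (s / sqrt (real n)) ^ n - complex_of_real ((1 + (- v / 2 * s\<^sup>2) / real n) ^ n))
            \<le> \<bar>s\<bar> ^ 3 * M / 6 / sqrt (real n)) at_top"
        using eventually_gt_at_top[of 0]
      proof eventually_elim
        case (elim n)
        let ?t = "s / sqrt (real n)"
        have *: "1 + (- v / 2 * s\<^sup>2) / real n = 1 - v / 2 * ?t\<^sup>2"
          using elim by (simp add: power_divide)
        have "norm (\<psi> ?t ^ n - complex_of_real (1 - v / 2 * ?t\<^sup>2) ^ n) \<le> n * norm (\<psi> ?t - complex_of_real (1 - v / 2 * ?t\<^sup>2))"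
        proof (rule norm_power_diff[OF n\<psi>])
          have "0 \<le> v / 2 * s\<^sup>2 / real n" using v by simp
          then show "norm (complex_of_real (1 - v / 2 * ?t\<^sup>2)) \<le> 1"
            using elim unfolding norm_of_real by (simp add: power_divide)
        qed
        also have "\<dots> \<le> n * (\<bar>?t\<bar> ^ 3 * M / 6)" by (intro mult_left_mono \<psi>_taylor) simp
        also have "\<dots> = sqrt (real n) * sqrt (real n) * (\<bar>?t\<bar> ^ 3 * M / 6)" by simp
        also have "\<dots> = \<bar>s\<bar> ^ 3 * M / 6 / sqrt (real n)"
          using elim by (simp add: abs_divide power_divide power3_eq_cube field_simps del: real_sqrt_mult_self)
        finally show ?case unfolding * of_real_power .
      qed
    qed
    from tendsto_add[OF this E] show ?thesis by simp
  qed
  \<comment> \<open>The inversion integrand after the substitution; the Jacobian produces the factor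
    \<open>sqrt n\<close> in front of \<open>Z\<close>.\<close>
  define F where "F = (\<lambda>n s. indicator {-pi..pi} (s / sqrt (real n)) *\<^sub>R
      (fourier p (s / sqrt (real n)) ^ n * cis (- (s / sqrt (real n) * real (m n)))))"
  have F: "has_bochner_integral lborel (F n) (of_real (sqrt (real n) * (2 * pi * Z p (m n) n)))" if "n > 0" for n
    using that lborel_has_bochner_integral_real_affine_iff[of "1 / sqrt (real n)" "\<lambda>t. indicator {-pi..pi} t *\<^sub>R
      (fourier p t ^ n * cis (- (t * real (m n))))" "of_real (2 * pi * Z p (m n) n)" 0]
      fourier_inversion[OF p(1) sp, of n "m n"]
    by (simp add: F_def scaleR_conv_of_real)
  have Flim: "(\<lambda>n. F n s) \<longlonglongrightarrow> of_real (exp (- v / 2 * s\<^sup>2))" for s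
  proof -
    \<comment> \<open>The phase left over after centring; it disappears in the limit because
      \<open>m n\<close> differs from the mean by \<open>o(sqrt n)\<close>.\<close>
    have "(\<lambda>n. cis (- (s * ((real (m n) - lam * real n) / sqrt (real n))))) \<longlonglongrightarrow> cis (- (s * 0))"
      by (intro tendsto_intros m)
    from tendsto_mult[OF lim\<psi>[of s] this]
    have "(\<lambda>n. \<psi> (s / sqrt (real n)) ^ n * cis (- (s * ((real (m n) - lam * real n) / sqrt (real n)))))
        \<longlonglongrightarrow> of_real (exp (- v / 2 * s\<^sup>2))" by simp
    moreover have "eventually (\<lambda>n. \<psi> (s / sqrt (real n)) ^ n * cis (- (s * ((real (m n) - lam * real n) / sqrt (real n)))) = F n s) at_top"
    proof -
      have "eventually (\<lambda>n. \<bar>s\<bar> / sqrt (real n) < pi) at_top"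
        using pi_gt_zero by real_asymp
      then show ?thesis using eventually_gt_at_top[of 0]
      proof eventually_elim
        case (elim n)
        have "s / sqrt (real n) \<in> {-pi..pi}"
          using elim by (auto simp: abs_if field_simps split: if_splits)
        moreover have "cis (- (s / sqrt (real n) * lam)) ^ n * cis (- (s * ((real (m n) - lam * real n) / sqrt (real n))))
           = cis (- (s / sqrt (real n) * real (m n)))"
          unfolding Complex.DeMoivre cis_mult using elim by (intro arg_cong[where f=cis]) (simp add: field_simps)
        ultimately show ?case
          by (simp add: F_def \<psi>_def power_mult_distrib mult.assoc)
      qed
    qed
    ultimately show ?thesis by (rule Lim_transform_eventually)
  qed
  have Fle: "norm (F n s) \<le> exp (- (d / 6) * s\<^sup>2)" if "n > 0" for n s
  proof (cases "s / sqrt (real n) \<in> {-pi..pi}")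
    case True
    let ?t = "s / sqrt (real n)"
    have "norm (fourier p ?t) ^ n \<le> exp ((\<Sum>k. p k) - 1 - d / 6 * ?t\<^sup>2) ^ n"
      using True d by (intro power_mono norm_fourier_le_exp[where k=k] p sp) auto
    also have "\<dots> = exp (- (d / 6) * s\<^sup>2)"
      using p(2) that by (simp add: exp_of_nat_mult[symmetric] power_divide sums_iff)
    finally show ?thesis using True by (simp add: F_def norm_mult norm_power)
  qed (simp add: F_def)
  \<comment> \<open>The shift avoids \<open>n = 0\<close>, where division by \<open>sqrt 0\<close>
    gives 0 and the integrand is constantly 1, hence not dominated.\<close>
  have "(\<lambda>n. integral\<^sup>L lborel (F (Suc n))) \<longlonglongrightarrow> (\<integral>s. complex_of_real (exp (- v / 2 * s\<^sup>2)) \<partial>lborel)"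
  proof (rule integral_dominated_convergence)
    show "integrable lborel (\<lambda>s. exp (- (d / 6) * s\<^sup>2))"
      using d by (intro integrable.intros[OF has_bochner_integral_gaussian]) simp
    show "F (Suc n) \<in> borel_measurable lborel" for n
      using F[of "Suc n"] by (auto simp: has_bochner_integral_iff)
    show "AE s in lborel. (\<lambda>n. F (Suc n) s) \<longlonglongrightarrow> complex_of_real (exp (- v / 2 * s\<^sup>2))"
      using Flim by (intro AE_I2 LIMSEQ_Suc)
    show "AE s in lborel. norm (F (Suc n) s) \<le> exp (- (d / 6) * s\<^sup>2)" for n
      by (intro AE_I2 Fle) simp
  qed simp
  moreover have "integral\<^sup>L lborel (F (Suc n)) = of_real (sqrt (real (Suc n)) * (2 * pi * Z p (m (Suc n)) (Suc n)))" for n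
    using F[of "Suc n"] by (intro has_bochner_integral_integral_eq) simp
  moreover have "(\<integral>s. complex_of_real (exp (- v / 2 * s\<^sup>2)) \<partial>lborel) = of_real (sqrt (pi / (v / 2)))"
    using has_bochner_integral_gaussian[of "v / 2"] v
    by (subst integral_complex_of_real) (simp add: has_bochner_integral_integral_eq)
  ultimately have "(\<lambda>n. complex_of_real (sqrt (real (Suc n)) * (2 * pi * Z p (m (Suc n)) (Suc n))))
      \<longlonglongrightarrow> of_real (sqrt (pi / (v / 2)))" by simp
  then have "(\<lambda>n. sqrt (real (Suc n)) * (2 * pi * Z p (m (Suc n)) (Suc n))) \<longlonglongrightarrow> sqrt (pi / (v / 2))"
    by (simp only: tendsto_of_real_iff)
  then have "(\<lambda>n. sqrt (real n) * (2 * pi * Z p (m n) n)) \<longlonglongrightarrow> sqrt (pi / (v / 2))"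
    by (rule LIMSEQ_imp_Suc[of "\<lambda>n. sqrt (real n) * (2 * pi * Z p (m n) n)"])
  then show ?thesis using v by (intro exI[of _ "sqrt (pi / (v / 2))"]) simp
qed

section \<open>Order statistics\<close>

lemma BB_prob_mono_or:
  assumes p: "\<And>k. p k \<ge> 0" and E: "\<And>ys. ys \<in> BB m n \<Longrightarrow> E ys \<Longrightarrow> A ys \<or> B ys"
  shows "BB_prob p m n E \<le> BB_prob p m n A + BB_prob p m n B"
proof -
  have "(\<Sum>ys\<in>{ys\<in>BB m n. E ys}. wt p ys) \<le> (\<Sum>ys\<in>{ys\<in>BB m n. A ys} \<union> {ys\<in>BB m n. B ys}. wt p ys)"
    using E by (intro sum_mono2) (auto simp: finite_BB wt_nonneg p)
  also have "\<dots> \<le> (\<Sum>ys\<in>{ys\<in>BB m n. A ys}. wt p ys) + (\<Sum>ys\<in>{ys\<in>BB m n. B ys}. wt p ys)"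
    by (subst sum_Un) (auto simp: finite_BB wt_nonneg p intro!: sum_nonneg)
  finally show ?thesis
    unfolding BB_prob_def add_divide_distrib[symmetric] by (rule divide_right_mono) (intro Z_nonneg p)
qed

lemma BB_prob_nonneg: "(\<And>k. p k \<ge> 0) \<Longrightarrow> BB_prob p m n E \<ge> 0"
  unfolding BB_prob_def by (intro divide_nonneg_nonneg sum_nonneg wt_nonneg Z_nonneg)

lemma BB_prob_compl:
  assumes "Z p m n \<noteq> 0"
  shows "BB_prob p m n E = 1 - BB_prob p m n (\<lambda>ys. \<not> E ys)"
proof -
  have "(\<Sum>ys\<in>{ys\<in>BB m n. E ys}. wt p ys) + (\<Sum>ys\<in>{ys\<in>BB m n. \<not> E ys}. wt p ys) = Z p m n"
    unfolding Z_def by (subst sum.union_disjoint[symmetric]) (auto simp: finite_BB intro!: sum.cong)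
  then show ?thesis using assms by (simp add: BB_prob_def field_simps)
qed

lemma wt_tilt:
  assumes "c \<noteq> 0"
  shows "wt (\<lambda>k. t ^ k * w k / c) ys = t ^ sum_list ys / c ^ length ys * wt w ys"
  using assms by (induction ys) (auto simp: wt_def power_add field_simps)

text \<open>On \<open>BB m n\<close> tilting multiplies every weight by the same factor
  \<open>t ^ m / c ^ n\<close>, which cancels in the quotient.\<close>

lemma BB_prob_tilt:
  fixes c t :: real
  assumes "c \<noteq> 0" "t \<noteq> 0"
  shows "BB_prob (\<lambda>k. t ^ k * w k / c) m n E = BB_prob w m n E"
proof -
  have "(\<Sum>ys\<in>S. wt (\<lambda>k. t ^ k * w k / c) ys) = t ^ m / c ^ n * (\<Sum>ys\<in>S. wt w ys)" if "S \<subseteq> BB m n" for S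
    unfolding sum_distrib_left using that assms
    by (intro sum.cong refl) (auto simp: wt_tilt BB_def)
  then show ?thesis using assms by (simp add: BB_prob_def Z_def)
qed

lemma ord_stat_in_set:
  assumes "1 \<le> j" "j \<le> length ys"
  shows "ord_stat ys j \<in> set ys"
proof -
  have "ord_stat ys j \<in> set (rev (sort ys))"
    unfolding ord_stat_def using assms by (intro nth_mem) simp
  then show ?thesis by simp
qed

text \<open>In the decreasing rearrangement all entries from index \<open>j - 1\<close> on are below
  \<open>K\<close>, so only the first \<open>j - 1\<close> can reach it.\<close>

lemma length_filter_of_ord_stat_less:
  assumes "1 \<le> j" "j \<le> length ys" "ord_stat ys j < K"
  shows "length (filter (\<lambda>y. K \<le> y) ys) < j"
proof -
  define xs where "xs = rev (sort ys)"
  have "sorted_wrt (\<ge>) xs" by (simp add: xs_def sorted_wrt_rev)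
  then have less: "xs ! i < K" if "j - 1 \<le> i" "i < length xs" for i
    using that assms(3) sorted_wrt_nth_less[of "(\<ge>)" xs "j - 1" i]
    by (cases "i = j - 1") (auto simp: ord_stat_def xs_def)
  have "length (filter (\<lambda>y. K \<le> y) ys) = length (filter (\<lambda>y. K \<le> y) xs)"
    by (metis mset_filter mset_rev mset_sort size_mset xs_def)
  also have "\<dots> = card {i. i < length xs \<and> K \<le> xs ! i}" by (rule length_filter_conv_card)
  also have "\<dots> \<le> card {..<j - 1}"
    using less by (intro card_mono) (auto simp: not_le[symmetric])
  finally show ?thesis using assms by simp
qed

text \<open>If the j-th largest entry reaches \<open>K\<close>, then some entry does, and the
  truncated weight of \<open>ys\<close> is zero. The right-hand side is the total weight of all
  lists with such an entry.\<close>

lemma sum_ord_stat_ge_le: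
  assumes p: "\<And>k. p k \<ge> 0" and j: "1 \<le> j" "j \<le> n"
  shows "(\<Sum>ys\<in>{ys\<in>BB m n. K \<le> ord_stat ys j}. wt p ys)
    \<le> Z p m n - Z (\<lambda>k. if K \<le> k then 0 else p k) m n"
proof -
  let ?g = "\<lambda>k. if K \<le> k then 0 else p k"
  have w: "wt ?g ys = (if \<exists>y\<in>set ys. K \<le> y then 0 else wt p ys)" for ys
    by (induction ys) (auto simp: wt_def)
  have "(\<Sum>ys\<in>{ys\<in>BB m n. K \<le> ord_stat ys j}. wt p ys) = (\<Sum>ys\<in>{ys\<in>BB m n. K \<le> ord_stat ys j}. wt p ys - wt ?g ys)"
    using ord_stat_in_set j by (intro sum.cong refl) (fastforce simp: w BB_def)
  also have "\<dots> \<le> (\<Sum>ys\<in>BB m n. wt p ys - wt ?g ys)"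
    by (intro sum_mono2) (auto simp: finite_BB w wt_nonneg p)
  finally show ?thesis by (simp add: Z_def sum_subtractf)
qed

text \<open>Markov's inequality for \<open>2 powr (- N)\<close>, where \<open>N\<close> counts the boxes with at least \<open>K\<close> balls.\<close>

lemma sum_ord_stat_less_le:
  assumes p: "\<And>k. p k \<ge> 0" and j: "1 \<le> j" "j \<le> n"
  shows "(\<Sum>ys\<in>{ys\<in>BB m n. ord_stat ys j < K}. wt p ys)
    \<le> 2 ^ j * Z (\<lambda>k. if K \<le> k then p k / 2 else p k) m n"
proof -
  let ?g = "\<lambda>k. if K \<le> k then p k / 2 else p k"
  have w: "wt p ys = 2 ^ length (filter (\<lambda>y. K \<le> y) ys) * wt ?g ys" for ys
    by (induction ys) (auto simp: wt_def)
  have g: "wt ?g ys \<ge> 0" for ys by (rule wt_nonneg) (simp add: p)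
  have "(\<Sum>ys\<in>{ys\<in>BB m n. ord_stat ys j < K}. wt p ys) \<le> (\<Sum>ys\<in>{ys\<in>BB m n. ord_stat ys j < K}. 2 ^ j * wt ?g ys)"
  proof (rule sum_mono)
    fix ys assume "ys \<in> {ys\<in>BB m n. ord_stat ys j < K}"
    then have "length (filter (\<lambda>y. K \<le> y) ys) < j"
      using j by (intro length_filter_of_ord_stat_less) (auto simp: BB_def)
    then have "(2::real) ^ length (filter (\<lambda>y. K \<le> y) ys) \<le> 2 ^ j" by (intro power_increasing) auto
    then show "wt p ys \<le> 2 ^ j * wt ?g ys" unfolding w[of ys] using g by (rule mult_right_mono)
  qed
  also have "\<dots> \<le> (\<Sum>ys\<in>BB m n. 2 ^ j * wt ?g ys)"
    using g by (intro sum_mono2) (auto simp: finite_BB)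
  finally show ?thesis by (simp add: Z_def sum_distrib_left)
qed

lemma suminf_tail_eq:
  fixes p :: "nat \<Rightarrow> real"
  assumes "summable p"
  shows "(\<lambda>k. if K \<le> k then p k else 0) sums (\<Sum>l. p (l + K))"
proof -
  have "(\<lambda>l. if K \<le> l + K then p (l + K) else 0) sums (\<Sum>l. p (l + K))"
    using assms by (simp add: summable_iff_shift summable_sums)
  then show ?thesis
    by (subst (asm) sums_iff_shift) simp
qed

text \<open>The bounds for the numerators and the lower bound for \<open>Z p (m n) n\<close> share
  the order \<open>1 / sqrt n\<close>, which cancels in the quotient. Requiring
  \<open>K > Suc k\<close> leaves the atoms at \<open>k\<close> and \<open>Suc k\<close> untouched
  by truncation and halving, so one \<open>d\<close>, and hence one \<open>D\<close>, serves all
  such \<open>K\<close>.\<close>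

lemma ord_stat_tail_bounds:
  assumes p: "\<And>k. p k \<ge> 0" "p sums 1"
    and d: "0 < d" "d \<le> p k" "d \<le> p (Suc k)"
    and lim: "(\<lambda>n. sqrt (real n) * (2 * pi * Z p (m n) n)) \<longlonglongrightarrow> v" and v: "v > 0"
    and j: "1 \<le> j"
  shows "\<exists>D>0. eventually (\<lambda>n. Z p (m n) n > 0 \<and> (\<forall>K>Suc k.
      BB_prob p (m n) n (\<lambda>ys. K \<le> ord_stat ys j) \<le> D * (real n * (\<Sum>l. p (l + K))) \<and>
      BB_prob p (m n) n (\<lambda>ys. ord_stat ys j < K) \<le> D * exp (- (real n * (\<Sum>l. p (l + K))) / 2))) at_top"
proof -
  \<comment> \<open>Twice the \<open>6 * pi / d\<close> of the Fourier bounds; the extra 2 absorbs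
    \<open>n / (n - 1)\<close>.\<close>
  define c where "c = sqrt (12 * pi / d)"
  \<comment> \<open>The factor \<open>2 ^ j\<close> comes from undoing the halving, and
    \<open>v / 2\<close> is an eventual lower bound for the rescaled partition function.\<close>
  define D where "D = 2 ^ j * c / (v / 2)"
  have c: "c > 0" using d by (simp add: c_def)
  have sp: "summable p" using p(2) by (rule sums_summable)
  have "eventually (\<lambda>n. sqrt (real n) * (2 * pi * Z p (m n) n) > v / 2) at_top"
    using lim v by (intro order_tendstoD(1)) auto
  then have "eventually (\<lambda>n. Z p (m n) n > 0 \<and> (\<forall>K>Suc k.
      BB_prob p (m n) n (\<lambda>ys. K \<le> ord_stat ys j) \<le> D * (real n * (\<Sum>l. p (l + K))) \<and>
      BB_prob p (m n) n (\<lambda>ys. ord_stat ys j < K) \<le> D * exp (- (real n * (\<Sum>l. p (l + K))) / 2))) at_top"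
    using eventually_ge_at_top[of "max 2 j"]
  proof eventually_elim
    case (elim n)
    \<comment> \<open>\<open>n \<ge> 2\<close> keeps \<open>n - 1\<close> positive in
      \<open>Z_diff_le\<close>, and \<open>j \<le> n\<close> makes the j-th order statistic an
      actual entry.\<close>
    then have n: "n \<ge> 2" "j \<le> n" by auto
    define s where "s = 2 * pi * sqrt (real n)"
    have s: "s > 0" using n by (simp add: s_def)
    have sZ: "s * Z p (m n) n > v / 2" using elim by (simp add: s_def mult_ac)
    then have Z: "Z p (m n) n > 0" using v s by (smt (verit) half_gt_zero mult_nonneg_nonpos)
    have prob_le: "x / Z p (m n) n \<le> D * y" if "s * x \<le> 2 ^ j * c * y" "y \<ge> 0" for x y
    proof -
      have "x / Z p (m n) n = (s * x) / (s * Z p (m n) n)" using s by simp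
      also have "\<dots> \<le> (2 ^ j * c * y) / (v / 2)"
        using that v c sZ by (intro frac_le) auto
      finally show ?thesis by (simp add: D_def mult_ac)
    qed
    have sq: "sqrt (real n) * sqrt (6 * pi / (d * real i)) \<le> c" if "real n \<le> 2 * real i" "i > 0" for i
    proof -
      have "real n * (6 * pi / (d * real i)) \<le> 2 * real i * (6 * pi / (d * real i))"
        using that d by (intro mult_right_mono) auto
      also have "\<dots> = 12 * pi / d" using that by simp
      finally show ?thesis unfolding c_def real_sqrt_mult[symmetric] by (rule real_sqrt_le_mono)
    qed
    have "BB_prob p (m n) n (\<lambda>ys. K \<le> ord_stat ys j) \<le> D * (real n * (\<Sum>l. p (l + K))) \<and>
      BB_prob p (m n) n (\<lambda>ys. ord_stat ys j < K) \<le> D * exp (- (real n * (\<Sum>l. p (l + K))) / 2)" if K: "K > Suc k" for K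
    proof
      let ?T = "\<Sum>l. p (l + K)"
      note tail = suminf_tail_eq[OF sp, of K]
      have T0: "?T \<ge> 0" using sp p(1) by (intro suminf_nonneg) (auto simp: summable_iff_shift)
      let ?f = "\<lambda>i. if K \<le> i then 0 else p i"
      have "2 * pi * (Z p (m n) n - Z ?f (m n) n) \<le> real n * (\<Sum>i. p i - ?f i) * sqrt (6 * pi / (d * real (n - 1)))"
        using p d n K sp by (intro Z_diff_le[where k=k]) (auto simp: sums_iff)
      also have "(\<Sum>i. p i - ?f i) = ?T"
        using tail by (subst sums_unique[OF tail]) (intro arg_cong[where f=suminf] ext, simp)
      finally have "s * (\<Sum>ys\<in>{ys\<in>BB (m n) n. K \<le> ord_stat ys j}. wt p ys)
          \<le> sqrt (real n) * (real n * ?T * sqrt (6 * pi / (d * real (n - 1))))"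
        using sum_ord_stat_ge_le[OF p(1) j n(2), where m="m n" and K=K]
        unfolding s_def mult.commute[of "2 * pi" "sqrt _"] mult.assoc[of "sqrt _"]
        by (intro mult_left_mono) (auto elim!: order.trans[rotated] intro!: mult_left_mono)
      also have "\<dots> = (sqrt (real n) * sqrt (6 * pi / (d * real (n - 1)))) * (real n * ?T)" by simp
      also have "\<dots> \<le> c * (real n * ?T)"
        using n T0 by (intro mult_right_mono sq) auto
      also have "\<dots> \<le> 2 ^ j * c * (real n * ?T)"
        using c T0 by (intro mult_right_mono) auto
      finally show "BB_prob p (m n) n (\<lambda>ys. K \<le> ord_stat ys j) \<le> D * (real n * ?T)"
        unfolding BB_prob_def using T0 by (intro prob_le) auto
      let ?g = "\<lambda>i. if K \<le> i then p i / 2 else p i"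
      have g: "?g sums (1 - ?T / 2)"
      proof -
        have "(\<lambda>i. p i - (if K \<le> i then p i else 0) / 2) sums (1 - ?T / 2)"
          by (intro sums_diff sums_divide tail p)
        also have "(\<lambda>i. p i - (if K \<le> i then p i else 0) / 2) = ?g" by auto
        finally show ?thesis .
      qed
      have "2 * pi * Z ?g (m n) n \<le> exp (- (real n * (1 - (\<Sum>i. ?g i)))) * sqrt (6 * pi / (d * real n))"
        using p d n K g by (intro Z_le_exp[where k=k]) (auto simp: sums_iff)
      also have "(\<Sum>i. ?g i) = 1 - ?T / 2" using g by (simp add: sums_iff)
      finally have Zg: "2 * pi * Z ?g (m n) n \<le> exp (- (real n * ?T) / 2) * sqrt (6 * pi / (d * real n))" by simp
      have "s * (\<Sum>ys\<in>{ys\<in>BB (m n) n. ord_stat ys j < K}. wt p ys) \<le> s * (2 ^ j * Z ?g (m n) n)"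
        using s by (intro mult_left_mono sum_ord_stat_less_le p j n) auto
      also have "\<dots> = sqrt (real n) * 2 ^ j * (2 * pi * Z ?g (m n) n)" by (simp add: s_def)
      also have "\<dots> \<le> sqrt (real n) * 2 ^ j * (exp (- (real n * ?T) / 2) * sqrt (6 * pi / (d * real n)))"
        using Zg by (intro mult_left_mono) auto
      also have "\<dots> = (sqrt (real n) * sqrt (6 * pi / (d * real n))) * (2 ^ j * exp (- (real n * ?T) / 2))" by simp
      also have "\<dots> \<le> c * (2 ^ j * exp (- (real n * ?T) / 2))"
        using n by (intro mult_right_mono sq) auto
      finally show "BB_prob p (m n) n (\<lambda>ys. ord_stat ys j < K) \<le> D * exp (- (real n * ?T) / 2)"
        unfolding BB_prob_def by (intro prob_le) (auto simp: mult_ac)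
    qed
    then show ?case using Z by blast
  qed
  moreover have "D > 0" using c v by (simp add: D_def)
  ultimately show ?thesis by blast
qed

section \<open>Level sequences\<close>

lemma eventually_Suc_le_mult:
  fixes f :: "nat \<Rightarrow> real"
  assumes "eventually (\<lambda>k. f k > 0) at_top" "(\<lambda>k. f (Suc k) / f k) \<longlonglongrightarrow> q" "q < r"
  shows "eventually (\<lambda>k. f (Suc k) \<le> r * f k) at_top"
  using assms(1) order_tendstoD(2)[OF assms(2,3)]
  by eventually_elim (simp add: field_simps)

text \<open>The polynomial factor does not change the limiting ratio, so the ratio test applies with
  any \<open>r\<close> between \<open>q\<close> and 1.\<close>

lemma summable_cubic_moment:
  fixes p :: "nat \<Rightarrow> real"
  assumes pos: "eventually (\<lambda>k. p k > 0) at_top" and lim: "(\<lambda>k. p (Suc k) / p k) \<longlonglongrightarrow> q" and q: "q < 1"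
  shows "summable (\<lambda>k. real k ^ 3 * p k)"
proof -
  obtain r where r: "q < r" "r < 1" using q dense by blast
  have pos3: "eventually (\<lambda>k. real k ^ 3 * p k > 0) at_top"
    using pos eventually_gt_at_top[of 0] by eventually_elim simp
  have "(\<lambda>k. (real (Suc k) / real k) ^ 3 * (p (Suc k) / p k)) \<longlonglongrightarrow> 1 ^ 3 * q"
    by (intro tendsto_mult tendsto_power lim) real_asymp
  then have "(\<lambda>k. (real (Suc k) ^ 3 * p (Suc k)) / (real k ^ 3 * p k)) \<longlonglongrightarrow> q"
    by (simp add: power_divide)
  from eventually_conj[OF eventually_Suc_le_mult[OF pos3 this r(1)] pos3]
  obtain N where N: "\<And>k. k \<ge> N \<Longrightarrow> real (Suc k) ^ 3 * p (Suc k) \<le> r * (real k ^ 3 * p k)"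
      "\<And>k. k \<ge> N \<Longrightarrow> real k ^ 3 * p k > 0"
    by (auto simp: eventually_at_top_linorder)
  show ?thesis
  proof (rule summable_ratio_test[OF r(2)])
    fix k assume k: "k \<ge> N"
    have "\<bar>real (Suc k) ^ 3 * p (Suc k)\<bar> = real (Suc k) ^ 3 * p (Suc k)" "\<bar>real k ^ 3 * p k\<bar> = real k ^ 3 * p k"
      using N(2)[of k] N(2)[of "Suc k"] k by auto
    then show "norm (real (Suc k) ^ 3 * p (Suc k)) \<le> r * norm (real k ^ 3 * p k)"
      using N(1)[OF k] by (simp only: real_norm_def)
  qed
qed

text \<open>\<open>Max\<close> is informative only on finite nonempty sets. Finiteness follows from
  \<open>f \<longlonglongrightarrow> 0\<close>; each fixed index with \<open>f k > 0\<close> enters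
  the set for large \<open>n\<close>, which gives nonemptiness and the divergence of
  \<open>K\<close>.\<close>

lemma Max_level_set:
  fixes f :: "nat \<Rightarrow> real"
  assumes f: "f \<longlonglongrightarrow> 0" and pos: "eventually (\<lambda>k. f k > 0) at_top"
    and K_def: "\<And>n::nat. K n = Max {k. f k \<ge> 1 / real n}"
  shows "filterlim K at_top at_top"
    and "eventually (\<lambda>n. f (K n) \<ge> 1 / real n \<and> (\<forall>k>K n. f k < 1 / real n)) at_top"
proof -
  have fin: "finite {k. f k \<ge> 1 / real n}" if "n > 0" for n
  proof -
    have "eventually (\<lambda>k. f k < 1 / real n) at_top" using f that by (intro order_tendstoD(2)) auto
    then obtain N where "\<And>k. k \<ge> N \<Longrightarrow> f k < 1 / real n" by (auto simp: eventually_at_top_linorder)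
    then have "{k. f k \<ge> 1 / real n} \<subseteq> {..<N}" by (auto simp: not_less[symmetric])
    then show ?thesis by (rule finite_subset) simp
  qed
  have ev: "eventually (\<lambda>n. n > 0 \<and> f k \<ge> 1 / real n) at_top" if "f k > 0" for k
  proof -
    have "(\<lambda>n. 1 / real n) \<longlonglongrightarrow> 0" by real_asymp
    from order_tendstoD(2)[OF this that] show ?thesis
      using eventually_gt_at_top[of 0] by eventually_elim auto
  qed
  obtain N where N: "\<And>k. k \<ge> N \<Longrightarrow> f k > 0" using pos by (auto simp: eventually_at_top_linorder)
  show "filterlim K at_top at_top"
    unfolding filterlim_at_top
  proof
    fix B :: nat
    show "eventually (\<lambda>n. B \<le> K n) at_top"
      using ev[OF N[OF max.cobounded2[of N B]]]
    proof eventually_elim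
      case (elim n)
      then have "max B N \<le> K n" unfolding K_def using fin[of n] by (intro Max_ge) auto
      then show ?case by simp
    qed
  qed
  show "eventually (\<lambda>n. f (K n) \<ge> 1 / real n \<and> (\<forall>k>K n. f k < 1 / real n)) at_top"
    using ev[OF N[OF order.refl]]
  proof eventually_elim
    case (elim n)
    have "K n \<in> {k. f k \<ge> 1 / real n}" unfolding K_def using elim fin[of n] by (intro Max_in) auto
    moreover have "f k < 1 / real n" if "k > K n" for k
      using that Max_ge[of "{k. f k \<ge> 1 / real n}" k] elim fin[of n] by (fastforce simp: K_def)
    ultimately show ?case by auto
  qed
qed

lemma exp_neg_half_tendsto_0:
  assumes "filterlim f at_top F"
  shows "((\<lambda>n. D * exp (- f n / 2 :: real)) \<longlongrightarrow> 0) F"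
proof -
  have "((\<lambda>x. D * exp (- x / 2 :: real)) \<longlongrightarrow> 0) at_top" by real_asymp
  then show ?thesis using assms by (rule filterlim_compose)
qed

section \<open>From tail bounds to vanishing probabilities and tightness\<close>

context
  fixes p T :: "nat \<Rightarrow> real" and D :: real and m :: "nat \<Rightarrow> nat" and j k0 :: nat
  assumes p: "\<And>k. p k \<ge> 0" and D: "D > 0"
    and tails: "eventually (\<lambda>n. \<forall>K>k0.
      BB_prob p (m n) n (\<lambda>ys. K \<le> ord_stat ys j) \<le> D * (real n * T K) \<and>
      BB_prob p (m n) n (\<lambda>ys. ord_stat ys j < K) \<le> D * exp (- (real n * T K) / 2)) at_top"
begin

lemma prob_ord_stat_ge_tendsto_0:
  assumes K: "filterlim K at_top at_top" and lim: "(\<lambda>n. real n * T (K n)) \<longlonglongrightarrow> 0"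
  shows "(\<lambda>n. BB_prob p (m n) n (\<lambda>ys. K n \<le> ord_stat ys j)) \<longlonglongrightarrow> 0"
proof (rule tendsto_sandwich[OF _ _ tendsto_const])
  show "(\<lambda>n. D * (real n * T (K n))) \<longlonglongrightarrow> 0" using lim by (rule tendsto_mult_right_zero)
  show "eventually (\<lambda>n. BB_prob p (m n) n (\<lambda>ys. K n \<le> ord_stat ys j) \<le> D * (real n * T (K n))) at_top"
    using tails filterlim_at_top[THEN iffD1, OF K, rule_format, of "Suc k0"] by eventually_elim auto
qed (intro always_eventually allI BB_prob_nonneg p)

lemma prob_ord_stat_less_tendsto_0:
  assumes K: "filterlim K at_top at_top" and lim: "filterlim (\<lambda>n. real n * T (K n)) at_top at_top"
  shows "(\<lambda>n. BB_prob p (m n) n (\<lambda>ys. ord_stat ys j < K n)) \<longlonglongrightarrow> 0"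
proof (rule tendsto_sandwich[OF _ _ tendsto_const])
  show "(\<lambda>n. D * exp (- (real n * T (K n)) / 2)) \<longlonglongrightarrow> 0" using lim by (rule exp_neg_half_tendsto_0)
  show "eventually (\<lambda>n. BB_prob p (m n) n (\<lambda>ys. ord_stat ys j < K n) \<le> D * exp (- (real n * T (K n)) / 2)) at_top"
    using tails filterlim_at_top[THEN iffD1, OF K, rule_format, of "Suc k0"] by eventually_elim auto
qed (intro always_eventually allI BB_prob_nonneg p)

lemma prob_ord_stat_between_tendsto_0:
  assumes A: "filterlim A at_top at_top" "filterlim (\<lambda>n. real n * T (A n)) at_top at_top"
    and B: "filterlim B at_top at_top" "(\<lambda>n. real n * T (B n)) \<longlonglongrightarrow> 0"
  shows "(\<lambda>n. BB_prob p (m n) n (\<lambda>ys. \<not> (A n \<le> ord_stat ys j \<and> ord_stat ys j < B n))) \<longlonglongrightarrow> 0"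
proof (rule tendsto_sandwich[OF _ _ tendsto_const])
  show "(\<lambda>n. BB_prob p (m n) n (\<lambda>ys. ord_stat ys j < A n) + BB_prob p (m n) n (\<lambda>ys. B n \<le> ord_stat ys j)) \<longlonglongrightarrow> 0"
    using tendsto_add[OF prob_ord_stat_less_tendsto_0[OF A] prob_ord_stat_ge_tendsto_0[OF B]] by simp
  show "eventually (\<lambda>n. BB_prob p (m n) n (\<lambda>ys. \<not> (A n \<le> ord_stat ys j \<and> ord_stat ys j < B n))
     \<le> BB_prob p (m n) n (\<lambda>ys. ord_stat ys j < A n) + BB_prob p (m n) n (\<lambda>ys. B n \<le> ord_stat ys j)) at_top"
    by (intro always_eventually allI BB_prob_mono_or p) auto
qed (intro always_eventually allI BB_prob_nonneg p)

text \<open>Moving the level by \<open>L\<close> changes \<open>n * T\<close> by at least the factor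
  \<open>r ^ L\<close>: above the window it is at most \<open>C * r ^ L\<close>, below it at least
  \<open>inverse (r ^ L)\<close>. Both resulting probabilities are small for large \<open>L\<close>,
  uniformly in large \<open>n\<close>.\<close>

lemma tight_ord_stat:
  assumes r: "0 < r" "r < 1" and T: "eventually (\<lambda>k. T (Suc k) \<le> r * T k) at_top"
    and K: "filterlim K at_top at_top"
    and lower: "eventually (\<lambda>n. T (K n) \<ge> 1 / real n) at_top"
    and upper: "eventually (\<lambda>n. T (K n + 2) \<le> C / real n) at_top"
  shows "tight (\<lambda>n. BB_prob p (m n) n) (\<lambda>n ys. real (ord_stat ys j) - real (K n))"
  unfolding tight_def
proof (intro allI impI)
  fix \<epsilon> :: real assume \<epsilon>: "\<epsilon> > 0"
  obtain N where N: "\<And>k. k \<ge> N \<Longrightarrow> T (Suc k) \<le> r * T k"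
    using T by (auto simp: eventually_at_top_linorder)
  have T_le: "T (k + L) \<le> r ^ L * T k" if "k \<ge> N" for k L
  proof (induction L)
    case (Suc L)
    have "T (k + Suc L) \<le> r * T (k + L)" using N[of "k + L"] that by simp
    also have "\<dots> \<le> r * (r ^ L * T k)" using Suc r by (intro mult_left_mono) auto
    finally show ?case by (simp add: mult_ac)
  qed simp
  have "(\<lambda>L. D * C * r ^ L) \<longlonglongrightarrow> 0"
    using r by (intro tendsto_mult_right_zero LIMSEQ_power_zero) simp
  then have "eventually (\<lambda>L. D * C * r ^ L < \<epsilon> / 2) at_top"
    using \<epsilon> by (intro order_tendstoD(2)) auto
  moreover have "filterlim (\<lambda>L. inverse (r ^ L)) at_top sequentially"
    using r by (intro filterlim_inverse_at_top LIMSEQ_power_zero) auto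
  from order_tendstoD(2)[OF exp_neg_half_tendsto_0[OF this], of "\<epsilon> / 2" D]
  have "eventually (\<lambda>L. D * exp (- inverse (r ^ L) / 2) < \<epsilon> / 2) at_top" using \<epsilon> by simp
  ultimately have "eventually (\<lambda>L. D * C * r ^ L < \<epsilon> / 2 \<and> D * exp (- inverse (r ^ L) / 2) < \<epsilon> / 2) at_top"
    by (rule eventually_conj)
  then obtain L where L: "D * C * r ^ L < \<epsilon> / 2" "D * exp (- inverse (r ^ L) / 2) < \<epsilon> / 2"
    by (auto simp: eventually_at_top_linorder)
  show "\<exists>c. eventually (\<lambda>n. BB_prob p (m n) n (\<lambda>ys. \<bar>real (ord_stat ys j) - real (K n)\<bar> > c) \<le> \<epsilon>) at_top"
  proof (intro exI)
    \<comment> \<open>The radius is \<open>L + 2\<close> because the upper bound on \<open>T\<close>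
      starts at \<open>K n + 2\<close>. Taking \<open>K n\<close> beyond \<open>N + L + k0\<close>
      makes the subtraction \<open>K n - L\<close> genuine and keeps that level in the range of both
      the decay and the tail bounds.\<close>
    show "eventually (\<lambda>n. BB_prob p (m n) n (\<lambda>ys. \<bar>real (ord_stat ys j) - real (K n)\<bar> > real (L + 2)) \<le> \<epsilon>) at_top"
      using tails lower upper filterlim_at_top[THEN iffD1, OF K, rule_format, of "Suc (N + L + k0)"]
        eventually_gt_at_top[of 0]
    proof eventually_elim
      case (elim n)
      have "BB_prob p (m n) n (\<lambda>ys. \<bar>real (ord_stat ys j) - real (K n)\<bar> > real (L + 2))
         \<le> BB_prob p (m n) n (\<lambda>ys. K n + 2 + L \<le> ord_stat ys j) + BB_prob p (m n) n (\<lambda>ys. ord_stat ys j < K n - L)"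
        using elim by (intro BB_prob_mono_or p) auto
      also have "BB_prob p (m n) n (\<lambda>ys. K n + 2 + L \<le> ord_stat ys j) \<le> D * (real n * T (K n + 2 + L))"
        using elim by simp
      also have "\<dots> \<le> D * (real n * (r ^ L * (C / real n)))"
      proof -
        have "T (K n + 2 + L) \<le> r ^ L * T (K n + 2)" using elim by (intro T_le) simp
        also have "\<dots> \<le> r ^ L * (C / real n)" using elim r by (intro mult_left_mono) auto
        finally show ?thesis using D by (intro mult_left_mono) auto
      qed
      also have "\<dots> \<le> \<epsilon> / 2" using L elim by (simp add: mult_ac)
      also have "BB_prob p (m n) n (\<lambda>ys. ord_stat ys j < K n - L) \<le> D * exp (- (real n * T (K n - L)) / 2)"
        using elim by simp
      also have "\<dots> \<le> D * exp (- inverse (r ^ L) / 2)"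
      proof -
        have "1 / real n \<le> T (K n)" using elim by simp
        also have "T (K n) \<le> r ^ L * T (K n - L)" using T_le[of "K n - L" L] elim by simp
        finally have "inverse (r ^ L) \<le> real n * T (K n - L)"
          using r elim by (simp add: field_simps power_divide)
        then show ?thesis using D by (intro mult_left_mono) auto
      qed
      also have "\<dots> \<le> \<epsilon> / 2" using L by simp
      finally show ?case by simp
    qed
  qed
qed

end

text \<open>For the last claim, \<open>p (Suc l) \<le> r * p l\<close> for all large
  \<open>l\<close> is summed over \<open>l \<ge> k\<close>.\<close>

lemma tail_properties:
  fixes p :: "nat \<Rightarrow> real"
  assumes p: "\<And>k. p k \<ge> 0" "summable p" and pos: "eventually (\<lambda>k. p k > 0) at_top"
    and lim: "(\<lambda>k. p (Suc k) / p k) \<longlonglongrightarrow> q"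
    and T_def: "\<And>k. T k = (\<Sum>l. p (l + k))"
  shows "T k > 0" and "T k = p k + T (Suc k)" and "T \<longlonglongrightarrow> 0"
    and "q < r \<Longrightarrow> eventually (\<lambda>k. T (Suc k) \<le> r * T k) at_top"
proof -
  have s: "summable (\<lambda>l. p (l + k))" for k using p by (simp add: summable_iff_shift)
  show "T k > 0" for k
  proof -
    obtain N where "\<And>k. k \<ge> N \<Longrightarrow> p k > 0" using pos by (auto simp: eventually_at_top_linorder)
    then have "p (N + k) > 0" by simp
    then show ?thesis unfolding T_def using p by (intro suminf_pos2[OF s]) auto
  qed
  show "T k = p k + T (Suc k)" for k
    unfolding T_def using suminf_split_head[OF s, of k] by simp
  show "T \<longlonglongrightarrow> 0"
    using suminf_exist_split2[OF p(2)] by (simp add: T_def[abs_def])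
  show "eventually (\<lambda>k. T (Suc k) \<le> r * T k) at_top" if "q < r"
  proof -
    obtain N where N: "\<And>k. k \<ge> N \<Longrightarrow> p (Suc k) \<le> r * p k"
      using eventually_Suc_le_mult[OF pos lim \<open>q < r\<close>] by (auto simp: eventually_at_top_linorder)
    have "T (Suc k) \<le> r * T k" if "k \<ge> N" for k
    proof -
      have "T (Suc k) \<le> (\<Sum>l. r * p (l + k))"
        unfolding T_def using N that by (intro suminf_le s summable_mult) auto
      also have "\<dots> = r * T k" unfolding T_def by (rule suminf_mult[OF s])
      finally show ?thesis .
    qed
    then show ?thesis by (auto simp: eventually_at_top_linorder)
  qed
qed


text \<open>A single step of the level now changes \<open>n * T\<close> by a factor tending to 0.
  The first two claims serve \<open>k1\<close> and \<open>k2\<close>, which have a step to spare on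
  either side. The last two serve \<open>k3\<close>: the geometric mean of consecutive tails differs
  from each of them by the square root of their ratio, and this already suffices on both
  sides.\<close>

lemma level_ratio_tendsto_0:
  fixes T :: "nat \<Rightarrow> real"
  assumes T: "\<And>k. T k > 0" and R: "(\<lambda>k. T (Suc k) / T k) \<longlonglongrightarrow> 0"
    and K: "filterlim K at_top at_top"
  shows "eventually (\<lambda>n. T (K n) \<ge> 1 / real n) at_top \<Longrightarrow> filterlim (\<lambda>n. real n * T (K n - 1)) at_top at_top"
    and "eventually (\<lambda>n. T (Suc (K n)) \<le> C / real n) at_top \<Longrightarrow> (\<lambda>n. real n * T (K n + 2)) \<longlonglongrightarrow> 0"
    and "eventually (\<lambda>n. sqrt (T (K n) * T (Suc (K n))) \<ge> 1 / real n) at_top \<Longrightarrow> filterlim (\<lambda>n. real n * T (K n)) at_top at_top"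
    and "eventually (\<lambda>n. sqrt (T (Suc (K n)) * T (Suc (Suc (K n)))) \<le> 1 / real n) at_top \<Longrightarrow> (\<lambda>n. real n * T (K n + 2)) \<longlonglongrightarrow> 0"
proof -
  define R where "R = (\<lambda>k. T (Suc k) / T k)"
  have R0: "R k > 0" for k using T by (simp add: R_def)
  have Rlim: "R \<longlonglongrightarrow> 0" using R by (simp add: R_def)
  have TS: "T (Suc k) = R k * T k" for k using T[of k] by (simp add: R_def)
  have K1: "filterlim (\<lambda>n. K n - 1) at_top at_top"
    using filterlim_minus_const_nat_at_top K by (rule filterlim_compose)
  have KS: "filterlim (\<lambda>n. Suc (K n)) at_top at_top"
    using filterlim_Suc K by (rule filterlim_compose)
  have Kge: "eventually (\<lambda>n. 1 \<le> K n) at_top" using K by (simp add: filterlim_at_top)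
  have sR: "(\<lambda>k. sqrt (R k)) \<longlonglongrightarrow> 0" using tendsto_real_sqrt[OF Rlim] by simp
  show "filterlim (\<lambda>n. real n * T (K n - 1)) at_top at_top" if "eventually (\<lambda>n. T (K n) \<ge> 1 / real n) at_top"
  proof (rule filterlim_at_top_mono)
    show "filterlim (\<lambda>n. inverse (R (K n - 1))) at_top at_top"
      using filterlim_compose[OF Rlim K1] R0 by (intro filterlim_inverse_at_top) auto
    show "eventually (\<lambda>n. inverse (R (K n - 1)) \<le> real n * T (K n - 1)) at_top"
      using that Kge eventually_gt_at_top[of 0]
    proof eventually_elim
      case (elim n)
      then have "T (K n) = R (K n - 1) * T (K n - 1)" using TS[of "K n - 1"] by simp
      then show ?case using elim R0[of "K n - 1"] by (simp add: field_simps)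
    qed
  qed
  show "(\<lambda>n. real n * T (K n + 2)) \<longlonglongrightarrow> 0" if "eventually (\<lambda>n. T (Suc (K n)) \<le> C / real n) at_top"
  proof (rule tendsto_sandwich[OF _ _ tendsto_const])
    show "(\<lambda>n. R (Suc (K n)) * C) \<longlonglongrightarrow> 0"
      using filterlim_compose[OF Rlim KS] by (rule tendsto_mult_left_zero)
    show "eventually (\<lambda>n. real n * T (K n + 2) \<le> R (Suc (K n)) * C) at_top"
      using that eventually_gt_at_top[of 0]
    proof eventually_elim
      case (elim n)
      then have "real n * T (Suc (K n)) \<le> C" by (simp add: field_simps)
      then have "R (Suc (K n)) * (real n * T (Suc (K n))) \<le> R (Suc (K n)) * C"
        using R0[of "Suc (K n)"] by (intro mult_left_mono) auto
      then show ?case using TS[of "Suc (K n)"] by (simp add: mult_ac)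
    qed
  qed (use T in \<open>simp add: less_imp_le\<close>)
  show "filterlim (\<lambda>n. real n * T (K n)) at_top at_top"
    if "eventually (\<lambda>n. sqrt (T (K n) * T (Suc (K n))) \<ge> 1 / real n) at_top"
  proof (rule filterlim_at_top_mono)
    show "filterlim (\<lambda>n. inverse (sqrt (R (K n)))) at_top at_top"
      using filterlim_compose[OF sR K] R0 by (intro filterlim_inverse_at_top) auto
    show "eventually (\<lambda>n. inverse (sqrt (R (K n))) \<le> real n * T (K n)) at_top"
      using that eventually_gt_at_top[of 0]
    proof eventually_elim
      case (elim n)
      have "T (K n) * T (Suc (K n)) = (T (K n))\<^sup>2 * R (K n)"
        by (simp add: TS[of "K n"] power2_eq_square)
      then have "sqrt (T (K n) * T (Suc (K n))) = T (K n) * sqrt (R (K n))"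
        using T[of "K n"] by (simp add: real_sqrt_mult)
      then show ?case using elim R0[of "K n"] by (simp add: field_simps)
    qed
  qed
  show "(\<lambda>n. real n * T (K n + 2)) \<longlonglongrightarrow> 0"
    if "eventually (\<lambda>n. sqrt (T (Suc (K n)) * T (Suc (Suc (K n)))) \<le> 1 / real n) at_top"
  proof (rule tendsto_sandwich[OF _ _ tendsto_const])
    show "(\<lambda>n. sqrt (R (Suc (K n)))) \<longlonglongrightarrow> 0"
      using filterlim_compose[OF sR KS] .
    show "eventually (\<lambda>n. real n * T (K n + 2) \<le> sqrt (R (Suc (K n)))) at_top"
      using that eventually_gt_at_top[of 0]
    proof eventually_elim
      case (elim n)
      let ?k = "Suc (K n)"
      \<comment> \<open>The smaller tail is the geometric mean times the square root of the
        ratio.\<close>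
      have "(T (Suc ?k))\<^sup>2 = T ?k * T (Suc ?k) * R ?k"
        by (simp add: TS[of ?k] power2_eq_square)
      then have "T (Suc ?k) = sqrt (T ?k * T (Suc ?k)) * sqrt (R ?k)"
        using T[of "Suc ?k"] by (metis abs_of_pos real_sqrt_abs real_sqrt_mult)
      also have "\<dots> \<le> 1 / real n * sqrt (R ?k)"
        using elim R0[of ?k] by (intro mult_right_mono) auto
      finally show ?case using elim by (simp add: field_simps)
    qed
  qed (use T in \<open>simp add: less_imp_le\<close>)
qed

text \<open>For \<open>a \<noteq> 0\<close> the radius of convergence is \<open>inverse a\<close>,
  so the second claim restates that \<open>tau\<close> lies inside it.\<close>

lemma ratio_limit_times_less_1:
  fixes w :: "nat \<Rightarrow> real"
  assumes w: "\<And>k. w k \<ge> 0" and pos: "eventually (\<lambda>k. w k > 0) at_top"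
    and ratio: "(\<lambda>k. w (Suc k) / w k) \<longlonglongrightarrow> a"
    and tau: "0 < tau" "ereal tau < conv_radius w"
  shows "a \<ge> 0" "tau * a < 1"
proof -
  show a: "a \<ge> 0" using ratio by (rule LIMSEQ_le_const) (simp add: w)
  show "tau * a < 1"
  proof (cases "a = 0")
    case False
    have "(\<lambda>k. inverse (w (Suc k) / w k)) \<longlonglongrightarrow> inverse a"
      using ratio False by (rule tendsto_inverse)
    then have "conv_radius w = ereal (inverse a)"
      using w False by (intro conv_radius_ratio_limit_nonzero[of _ "inverse a"]) auto
    then show ?thesis using tau False a by (simp add: field_simps)
  qed simp
qed

section \<open>The tilted law and its three level sequences\<close>

theorem theorem18p16:
  fixes w :: "nat \<Rightarrow> real" and a lam tau :: real and m :: "nat \<Rightarrow> nat" and j :: nat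
  assumes w_nonneg: "\<And>k. w k \<ge> 0"
    and w0: "w 0 > 0"
    and w_pos: "eventually (\<lambda>k. w k > 0) at_top"
    and ratio: "(\<lambda>k. w (Suc k) / w k) \<longlonglongrightarrow> a"
    and m_asym: "(\<lambda>n. real (m n) - lam * real n) \<in> o(\<lambda>n. sqrt (real n))"
    and lam_pos: "0 < lam" and lam_nu: "ereal lam < nu w"
    and tau_pos: "0 < tau" and tau_rho: "ereal tau < rho w"
    and Psi_tau: "Psi w tau = ereal lam"
    and j: "j \<ge> 1"
  defines "p \<equiv> (\<lambda>k. tau ^ k * w k / real_of_ereal (Phi w tau))"
  defines "Pi_tail \<equiv> (\<lambda>k. \<Sum>l. p (l + k))"
  defines "k1 \<equiv> (\<lambda>n::nat. Max {k. p k \<ge> 1 / real n})"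
  defines "k2 \<equiv> (\<lambda>n::nat. Max {k. Pi_tail k \<ge> 1 / real n})"
  defines "k3 \<equiv> (\<lambda>n::nat. Max {k. sqrt (Pi_tail k * Pi_tail (Suc k)) \<ge> 1 / real n})"
  defines "Pr \<equiv> (\<lambda>n. BB_prob w (m n) n)"
  shows "tight Pr (\<lambda>n ys. real (ord_stat ys j) - real (k1 n))
       \<and> tight Pr (\<lambda>n ys. real (ord_stat ys j) - real (k2 n))
       \<and> tight Pr (\<lambda>n ys. real (ord_stat ys j) - real (k3 n))
       \<and> (a = 0 \<longrightarrow>
            (\<lambda>n. Pr n (\<lambda>ys. \<bar>real (ord_stat ys j) - real (k1 n)\<bar> \<le> 1
                           \<and> \<bar>real (ord_stat ys j) - real (k2 n)\<bar> \<le> 1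
                           \<and> ord_stat ys j \<in> {k3 n, k3 n + 1})) \<longlonglongrightarrow> 1)"
proof -
  \<comment> \<open>\<open>tau * a\<close> is the limiting ratio of the tilted law \<open>p\<close>,
    which therefore has geometrically decaying tails.\<close>
  have q: "a \<ge> 0" "tau * a < 1"
    using ratio_limit_times_less_1[OF w_nonneg w_pos ratio tau_pos] tau_rho by (auto simp: rho_def)
  define c where "c = (\<Sum>k. w k * tau ^ k)"
  have sw: "summable (\<lambda>k. w k * tau ^ k)"
    using tau_rho tau_pos by (intro summable_in_conv_radius) (auto simp: rho_def)
  have "(\<lambda>k. ereal (w k * tau ^ k)) sums ereal c"
    unfolding sums_ereal c_def using sw by (rule summable_sums)
  then have Phi: "Phi w tau = ereal c" by (simp add: Phi_def sums_iff)
  have c: "c > 0" unfolding c_def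
    using w_nonneg tau_pos w0 by (intro suminf_pos2[OF sw, of 0]) auto
  have p_eq: "p = (\<lambda>k. tau ^ k * w k / c)" by (simp add: p_def Phi)
  have p: "p k \<ge> 0" for k using w_nonneg c tau_pos by (simp add: p_eq)
  have p_sums: "p sums 1"
    using sums_divide[OF summable_sums[OF sw], of c] c by (simp add: p_eq c_def[symmetric] mult_ac)
  then have sp: "summable p" by (rule sums_summable)
  have p_pos: "eventually (\<lambda>k. p k > 0) at_top"
    using w_pos by eventually_elim (use c tau_pos in \<open>simp add: p_eq\<close>)
  have p_ratio: "(\<lambda>k. p (Suc k) / p k) \<longlonglongrightarrow> tau * a"
    using tendsto_mult_left[OF ratio, of tau] c tau_pos by (simp add: p_eq field_simps)
  have p3: "summable (\<lambda>k. real k ^ 3 * p k)"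
    using p_pos p_ratio q(2) by (rule summable_cubic_moment)
  have p1: "summable (\<lambda>k. real k * p k)"
  proof (rule summable_comparison_test'[OF p3, of 0])
    fix k :: nat
    have "real k \<le> real k ^ 3" by (cases "k = 0") (auto intro: self_le_power)
    then show "norm (real k * p k) \<le> real k ^ 3 * p k"
      using p[of k] by (simp add: mult_right_mono)
  qed
  \<comment> \<open>With \<open>Phi w tau\<close> as normalisation, \<open>Psi w tau = lam\<close>
    says exactly that \<open>p\<close> has mean \<open>lam\<close>.\<close>
  have mean: "(\<lambda>k. real k * p k) sums lam"
  proof -
    have "(\<lambda>k. c * (real k * p k)) sums (c * (\<Sum>k. real k * p k))"
      using p1 by (intro sums_mult summable_sums)
    then have "(\<lambda>k. ereal (real k * w k * tau ^ k)) sums ereal (c * (\<Sum>k. real k * p k))"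
      unfolding sums_ereal using c by (simp add: p_eq mult_ac)
    then have "tdPhi w tau = ereal (c * (\<Sum>k. real k * p k))"
      by (simp add: tdPhi_def sums_iff)
    then have "(\<Sum>k. real k * p k) = lam"
      using Psi_tau c by (simp add: Psi_def Phi)
    then show ?thesis using p1 by (simp add: sums_iff)
  qed
  \<comment> \<open>Eventual positivity supplies the two adjacent atoms on which the Fourier bounds
    rest.\<close>
  obtain k where "\<And>i. i \<ge> k \<Longrightarrow> p i > 0" using p_pos by (auto simp: eventually_at_top_linorder)
  then have "p k > 0" "p (Suc k) > 0" by auto
  then obtain d where d: "0 < d" "d \<le> p k" "d \<le> p (Suc k)"
    by (intro that[of "min (p k) (p (Suc k))"]) auto
  have "(\<lambda>n. (real (m n) - lam * real n) / sqrt (real n)) \<longlonglongrightarrow> 0"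
    using m_asym by (rule smalloD_tendsto)
  then obtain v where v: "v > 0" "(\<lambda>n. sqrt (real n) * (2 * pi * Z p (m n) n)) \<longlonglongrightarrow> v"
    using local_limit[OF p p_sums mean p3 d] by blast
  obtain D where D: "D > 0" and ev: "eventually (\<lambda>n. Z p (m n) n > 0 \<and> (\<forall>K>Suc k.
      BB_prob p (m n) n (\<lambda>ys. K \<le> ord_stat ys j) \<le> D * (real n * Pi_tail K) \<and>
      BB_prob p (m n) n (\<lambda>ys. ord_stat ys j < K) \<le> D * exp (- (real n * Pi_tail K) / 2))) at_top"
    using ord_stat_tail_bounds[OF p p_sums d v(2,1) j] unfolding Pi_tail_def by blast
  then have tails: "eventually (\<lambda>n. \<forall>K>Suc k.
      BB_prob p (m n) n (\<lambda>ys. K \<le> ord_stat ys j) \<le> D * (real n * Pi_tail K) \<and>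
      BB_prob p (m n) n (\<lambda>ys. ord_stat ys j < K) \<le> D * exp (- (real n * Pi_tail K) / 2)) at_top"
    and Z_pos: "eventually (\<lambda>n. Z p (m n) n > 0) at_top"
    by (auto elim: eventually_mono)
  have Pr: "Pr = (\<lambda>n. BB_prob p (m n) n)"
    unfolding Pr_def p_eq using c tau_pos by (intro ext BB_prob_tilt[symmetric]) auto

  note tail = tail_properties[OF p sp p_pos p_ratio Pi_tail_def[THEN meta_eq_to_obj_eq, THEN fun_cong]]
  have T_Suc_le: "Pi_tail (Suc i) \<le> Pi_tail i" for i using tail(2)[of i] p[of i] by simp
  have T_ge: "p i \<le> Pi_tail i" for i using tail(2)[of i] tail(1)[of "Suc i"] by simp
  obtain r where r: "tau * a < r" "r < 1" using q(2) dense by blast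
  have r0: "r > 0" using r q tau_pos by (meson le_less_trans mult_nonneg_nonneg less_imp_le)
  note T_r = tail(4)[OF r(1)]

  have "(\<lambda>k. sqrt (Pi_tail k * Pi_tail (Suc k))) \<longlonglongrightarrow> sqrt (0 * 0)"
    by (intro tendsto_intros tail LIMSEQ_Suc)
  then have sqrt_lim: "(\<lambda>k. sqrt (Pi_tail k * Pi_tail (Suc k))) \<longlonglongrightarrow> 0" by simp
  note K1 = Max_level_set[OF summable_LIMSEQ_zero[OF sp] p_pos k1_def[THEN meta_eq_to_obj_eq, THEN fun_cong]]
  have T_pos: "eventually (\<lambda>k. Pi_tail k > 0) at_top"
    "eventually (\<lambda>k. sqrt (Pi_tail k * Pi_tail (Suc k)) > 0) at_top"
    using tail(1) by auto
  note K2 = Max_level_set[OF tail(3) T_pos(1) k2_def[THEN meta_eq_to_obj_eq, THEN fun_cong]]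
  note K3 = Max_level_set[OF sqrt_lim T_pos(2) k3_def[THEN meta_eq_to_obj_eq, THEN fun_cong]]

  have low1: "eventually (\<lambda>n. Pi_tail (k1 n) \<ge> 1 / real n) at_top"
    using K1(2) by eventually_elim (use T_ge order.trans in blast)
  \<comment> \<open>From \<open>Pi_tail i = p i + Pi_tail (Suc i) \<le> p i + r * Pi_tail i\<close>
    the tail is at most \<open>p i / (1 - r)\<close>. Thus a level defined through \<open>p\<close>
    controls the tail up to a constant.\<close>
  have up1: "eventually (\<lambda>n. Pi_tail (Suc (k1 n)) \<le> (1 / (1 - r)) / real n) at_top"
  proof -
    have "eventually (\<lambda>i. Pi_tail i \<le> p i / (1 - r)) at_top"
      using T_r
    proof eventually_elim
      case (elim i)
      then have "(1 - r) * Pi_tail i \<le> p i" using tail(2)[of i] by (simp add: left_diff_distrib)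
      then show ?case using r by (simp add: field_simps)
    qed
    then have "eventually (\<lambda>n. Pi_tail (Suc (k1 n)) \<le> p (Suc (k1 n)) / (1 - r)) at_top"
      using filterlim_compose[OF filterlim_Suc K1(1)] by (rule eventually_compose_filterlim)
    then show ?thesis using K1(2)
    proof eventually_elim
      case (elim n)
      then have "p (Suc (k1 n)) / (1 - r) \<le> (1 / real n) / (1 - r)"
        using r by (intro divide_right_mono) (auto intro: less_imp_le)
      then show ?case using elim by (simp add: mult.commute)
    qed
  qed
  have low2: "eventually (\<lambda>n. Pi_tail (k2 n) \<ge> 1 / real n) at_top"
    and up2: "eventually (\<lambda>n. Pi_tail (Suc (k2 n)) \<le> 1 / real n) at_top"
    using K2(2) by (auto elim!: eventually_mono intro: less_imp_le)
  have sq3: "eventually (\<lambda>n. sqrt (Pi_tail (k3 n) * Pi_tail (Suc (k3 n))) \<ge> 1 / real n) at_top"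
    "eventually (\<lambda>n. sqrt (Pi_tail (Suc (k3 n)) * Pi_tail (Suc (Suc (k3 n)))) \<le> 1 / real n) at_top"
    using K3(2) by (auto elim!: eventually_mono intro: less_imp_le)
  \<comment> \<open>The geometric mean lies between the two consecutive tails, so \<open>k3\<close>
    can be compared with levels of \<open>Pi_tail\<close>.\<close>
  have sqrt_le: "sqrt (Pi_tail i * Pi_tail (Suc i)) \<le> Pi_tail i"
    and sqrt_ge: "Pi_tail (Suc i) \<le> sqrt (Pi_tail i * Pi_tail (Suc i))" for i
    using T_Suc_le[of i] tail(1)[of i] tail(1)[of "Suc i"]
    by (auto intro!: real_le_lsqrt real_le_rsqrt simp: power2_eq_square)
  have low3: "eventually (\<lambda>n. Pi_tail (k3 n) \<ge> 1 / real n) at_top"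
    using sq3(1) by eventually_elim (use sqrt_le order.trans in blast)
  \<comment> \<open>Maximality of \<open>k3 n\<close> bounds the mean of the tails at
    \<open>k3 n + 1\<close> and \<open>k3 n + 2\<close>, hence only the latter tail. This fixes the
    offset 2 in \<open>tight_ord_stat\<close>.\<close>
  have up3: "eventually (\<lambda>n. Pi_tail (k3 n + 2) \<le> 1 / real n) at_top"
    using sq3(2) by eventually_elim (use sqrt_ge order.trans in fastforce)
  have up1': "eventually (\<lambda>n. Pi_tail (k1 n + 2) \<le> (1 / (1 - r)) / real n) at_top"
    using up1 by eventually_elim (use T_Suc_le order.trans in fastforce)
  have up2': "eventually (\<lambda>n. Pi_tail (k2 n + 2) \<le> 1 / real n) at_top"
    using up2 by eventually_elim (use T_Suc_le order.trans in fastforce)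
  note tight = tight_ord_stat[OF p D tails r0 r(2) T_r]

  have "(\<lambda>n. Pr n (\<lambda>ys. \<bar>real (ord_stat ys j) - real (k1 n)\<bar> \<le> 1
                           \<and> \<bar>real (ord_stat ys j) - real (k2 n)\<bar> \<le> 1
                           \<and> ord_stat ys j \<in> {k3 n, k3 n + 1})) \<longlonglongrightarrow> 1" (is "(\<lambda>n. Pr n (?E n)) \<longlonglongrightarrow> 1")
    if a: "a = 0"
  proof -
    \<comment> \<open>With \<open>a = 0\<close> the limiting ratio of \<open>p\<close> is 0, so the
      tails shrink by every positive factor; \<open>e / 2\<close> makes the inequality
      strict.\<close>
    have R: "(\<lambda>k. Pi_tail (Suc k) / Pi_tail k) \<longlonglongrightarrow> 0"
    proof (rule order_tendstoI)
      fix e :: real assume "e < 0"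
      then show "eventually (\<lambda>k. e < Pi_tail (Suc k) / Pi_tail k) at_top"
        using tail(1) by (intro always_eventually allI) (meson divide_pos_pos less_trans)
    next
      fix e :: real assume e: "0 < e"
      then have "eventually (\<lambda>k. Pi_tail (Suc k) \<le> e / 2 * Pi_tail k) at_top"
        using a by (intro tail(4)) simp
      then show "eventually (\<lambda>k. Pi_tail (Suc k) / Pi_tail k < e) at_top"
      proof eventually_elim
        case (elim k)
        also have "e / 2 * Pi_tail k < e * Pi_tail k" using e tail(1)[of k] by simp
        finally show ?case using tail(1)[of k] by (simp add: field_simps)
      qed
    qed
    note lr = level_ratio_tendsto_0[OF tail(1) R]
    note sub = filterlim_compose[OF filterlim_minus_const_nat_at_top, of _ _ 1]
    note add = filterlim_compose[OF filterlim_add_const_nat_at_top, of _ _ 2]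
    note between = prob_ord_stat_between_tendsto_0[OF p D tails]
    note b1 = between[OF sub[OF K1(1)] lr(1)[OF K1(1) low1] add[OF K1(1)] lr(2)[OF K1(1) up1]]
    note b2 = between[OF sub[OF K2(1)] lr(1)[OF K2(1) low2] add[OF K2(1)] lr(2)[OF K2(1) up2]]
    note b3 = between[OF K3(1) lr(3)[OF K3(1) sq3(1)] add[OF K3(1)] lr(4)[OF K3(1) sq3(2)]]
    \<comment> \<open>On the integers, \<open>k - 1 \<le> Y < k + 2\<close> means distance at most
      one from \<open>k\<close>, also when \<open>k = 0\<close> and the subtraction truncates. The
      window for \<open>k3\<close> is exactly the two-point set.\<close>
    let ?A1 = "\<lambda>n ys. \<not> (k1 n - 1 \<le> ord_stat ys j \<and> ord_stat ys j < k1 n + 2)"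
    let ?A2 = "\<lambda>n ys. \<not> (k2 n - 1 \<le> ord_stat ys j \<and> ord_stat ys j < k2 n + 2)"
    let ?A3 = "\<lambda>n ys. \<not> (k3 n \<le> ord_stat ys j \<and> ord_stat ys j < k3 n + 2)"
    have "(\<lambda>n. BB_prob p (m n) n (\<lambda>ys. \<not> ?E n ys)) \<longlonglongrightarrow> 0"
    proof (rule tendsto_sandwich[OF _ _ tendsto_const])
      show "(\<lambda>n. BB_prob p (m n) n (?A1 n) + (BB_prob p (m n) n (?A2 n) + BB_prob p (m n) n (?A3 n))) \<longlonglongrightarrow> 0"
        using tendsto_add[OF b1 tendsto_add[OF b2 b3]] by simp
      show "eventually (\<lambda>n. BB_prob p (m n) n (\<lambda>ys. \<not> ?E n ys)
          \<le> BB_prob p (m n) n (?A1 n) + (BB_prob p (m n) n (?A2 n) + BB_prob p (m n) n (?A3 n))) at_top"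
      proof (intro always_eventually allI)
        fix n
        have "BB_prob p (m n) n (\<lambda>ys. \<not> ?E n ys) \<le> BB_prob p (m n) n (?A1 n) + BB_prob p (m n) n (\<lambda>ys. ?A2 n ys \<or> ?A3 n ys)"
          by (rule BB_prob_mono_or[OF p]) auto
        also have "BB_prob p (m n) n (\<lambda>ys. ?A2 n ys \<or> ?A3 n ys) \<le> BB_prob p (m n) n (?A2 n) + BB_prob p (m n) n (?A3 n)"
          by (rule BB_prob_mono_or[OF p]) auto
        finally show "BB_prob p (m n) n (\<lambda>ys. \<not> ?E n ys)
          \<le> BB_prob p (m n) n (?A1 n) + (BB_prob p (m n) n (?A2 n) + BB_prob p (m n) n (?A3 n))" by simp
      qed
    qed (intro always_eventually allI BB_prob_nonneg p)
    then have "(\<lambda>n. 1 - BB_prob p (m n) n (\<lambda>ys. \<not> ?E n ys)) \<longlonglongrightarrow> 1 - 0"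
      by (intro tendsto_diff tendsto_const)
    \<comment> \<open>Passing to the complement requires a nonzero partition function, available for
      large \<open>n\<close> from the local limit theorem.\<close>
    moreover have "eventually (\<lambda>n. 1 - BB_prob p (m n) n (\<lambda>ys. \<not> ?E n ys) = Pr n (?E n)) at_top"
      using Z_pos unfolding Pr by eventually_elim (rule BB_prob_compl[symmetric], simp)
    ultimately show ?thesis by (simp add: Lim_transform_eventually)
  qed
  then show ?thesis
    unfolding Pr using tight[OF K1(1) low1 up1'] tight[OF K2(1) low2 up2'] tight[OF K3(1) low3 up3] by blast
qed

end
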